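(* Assume $\langle L_{N-1},L_{N-2}\rangle_1\neq0$ and $\langle L_{N-3},L_{N-4}\rangle_1\ne 0$. Let $r_0,\dots,r_{N-1}$ be a sequence of polynomials such that $r_j$ is an arbitrary monic polynomial of degree $j$ independent of $t$ for $j<N-2$, and $r_j=\pi_{j,1}$ for $j=N-2,N-1$. Let $\mathcal{M}=(\langle r_j,r_k\rangle_1)_{j,k=0}^{N-1}$, $(\mu_{jk})=\mathcal{M}^{-1}$ and $$S_1(x,y)=-\sum_{j,k=0}^{N-1}r_j(x)w(x)\mu_{jk}\,\epsilon(r_kw)(y).$$ Then $$S_1(x,y)-K_2(x,y)=\begin{pmatrix}\epsilon(\pi_{N+1,1}w)(y)&\epsilon(\pi_{N,1}w)(y)\end{pmatrix}\begin{pmatrix}0&-\frac{M\tilde\tau}{2h_{N-1,0}}\\-\frac{M\tilde\tau}{2h_{N-2,0}}&\frac{Mt-\tilde\tau(M+N)}{2h_{N-1,0}}\end{pmatrix}\begin{pmatrix}L_{N-2}(x)\\L_{N-1}(x)\end{pmatrix}w(x),$$ where $K_2(x,y)$ is the kernel of the Laguerre polynomials $$K_2(x,y)=\left(\frac{y(t-\tilde\tau y)}{x(t-\tilde\tau x)}\right)^{\frac12}w_0^{\frac12}(x)w_0^{\frac12}(y)\frac{L_N(x)L_{N-1}(y)-L_N(y)L_{N-1}(x)}{h_{N-1,0}(x-y)} .$$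
   Context: $M>N\geq 4$ are integers with $N$ even, $\tau>-1$, $\tau\ne0$, $\tilde\tau=\frac{\tau}{2(1+\tau)}$, and $t\in\mathbb{C}$, $t\ne0$. $\mathbb{R}_+$ denotes the integration contour from $0$ to $\infty$: it is the half-line $[0,\infty)$ when $t/\tilde\tau\notin[0,\infty)$; when $t/\tilde\tau$ is on or too close to $(0,\infty)$, the half-line is deformed slightly into the upper or lower half plane so as to avoid $t/\tilde\tau$. All integrals $\int_0^\infty$ are along this contour, and $x,y$ lie on it. The weight is $$w(x)=e^{-\frac{Mx}{2}}x^{\frac{M-N-1}{2}}(t-\tilde\tau x)^{-\frac12},$$ with a branch of the square root that is continuous along the contour (the square root in $K_2$ is the corresponding one, i.e. the prefactor of the fraction in $K_2$ equals $w(x)w_0(y)/w(y)$). Put $\epsilon(x)=\frac12\mathrm{sgn}(x)$ (on a deformed contour $\epsilon(x-y)=\pm\frac12$ according to whether $x$ comes after or before $y$ along the contour), $\epsilon(f)(x)=\int_0^\infty\epsilon(x-y)f(y)\,dy$, and $$\langle f,g\rangle_1=\int_0^\infty\int_0^\infty\epsilon(x-y)f(x)g(y)w(x)w(y)\,dx\,dy .$$ $L_j$ is the monic Laguerre polynomial of degree $j$ orthogonal with respect to $w_0(x)=x^{M-N}e^{-Mx}$: $\int_0^\infty L_jL_kw_0\,dx=\delta_{jk}h_{j,0}$. The monic skew orthogonal polynomials $\pi_{2k,1}$, $\pi_{2k+1,1}$ (of degrees $2k$, $2k+1$) satisfy $\langle\pi_{2k+1,1},y^j\rangle_1=\langle\pi_{2k,1},y^j\rangle_1=0$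 for $j=0,\ldots,2k-1$. They exist if $\langle L_{2k-1},L_{2k-2}\rangle_1\ne0$; $\pi_{2k,1}$ is then unique, and $\pi_{2k+1,1}$ is unique up to adding a multiple of $\pi_{2k,1}$. Here $\pi_{N+1,1}$ is chosen to be $$\pi_{N+1,1}=L_{N+1}-\frac{\langle L_{N+1},L_{N-2}\rangle_1}{\langle L_{N-1},L_{N-2}\rangle_1}L_{N-1}+\frac{\langle L_{N+1},L_{N-1}\rangle_1}{\langle L_{N-1},L_{N-2}\rangle_1}L_{N-2}.$$ *)

theory Defs
  imports
    "HOL-Analysis.Analysis"
    "HOL-Computational_Algebra.Polynomial"
    "Jordan_Normal_Form.Gauss_Jordan_Elimination"
begin

definition ttau :: "real \<Rightarrow> complex" where
  "ttau \<tau> = of_real (\<tau> / (2 * (1 + \<tau>)))"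

(* The half-line [0,\<infinity>), or a deformation of it into the closed upper or the closed
   lower half plane, parametrized by s \<ge> 0.  Being in the right half plane, it avoids the cut
   of csqrt.  The Lipschitz condition is there because piecewise_C1_differentiable_on does not
   bound the derivative near the break points. *)
definition halfline_contour :: "(real \<Rightarrow> complex) \<Rightarrow> bool" where
  "halfline_contour \<gamma> \<longleftrightarrow>
     \<gamma> piecewise_C1_differentiable_on {0..} \<and>
     (\<exists>C. C-lipschitz_on {0..} \<gamma>) \<and>
     inj_on \<gamma> {0..} \<and>
     \<gamma> 0 = 0 \<and>
     (\<forall>s>0. Re (\<gamma> s) > 0) \<and>
     (\<exists>R. \<forall>s\<ge>R. \<gamma> s = of_real s) \<and>
     ((\<forall>s\<ge>0. Im (\<gamma> s) \<ge> 0) \<or> (\<forall>s\<ge>0. Im (\<gamma> s) \<le> 0))"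

definition contour_int :: "(real \<Rightarrow> complex) \<Rightarrow> (complex \<Rightarrow> complex) \<Rightarrow> complex" where
  "contour_int \<gamma> f = (LBINT s:{0..}. f (\<gamma> s) * vector_derivative \<gamma> (at s))"

(* A branch of the square root of t - ttau * x that is continuous along the contour. *)
definition sqrt_branch :: "(real \<Rightarrow> complex) \<Rightarrow> real \<Rightarrow> complex \<Rightarrow> (complex \<Rightarrow> complex) \<Rightarrow> bool" where
  "sqrt_branch \<gamma> \<tau> t \<rho> \<longleftrightarrow>
     continuous_on (\<gamma> ` {0..}) \<rho> \<and> (\<forall>x\<in>\<gamma> ` {0..}. \<rho> x ^ 2 = t - ttau \<tau> * x)"

definition weight0 :: "nat \<Rightarrow> nat \<Rightarrow> complex \<Rightarrow> complex" where
  "weight0 M N x = x ^ (M - N) * exp (- of_nat M * x)"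

(* csqrt x ^ k is the principal value of x powr (k/2) for Re x > 0.  Unlike powr it has the
   right value 1 at x = 0 when k = 0, that is, when M = N + 1. *)
definition weight :: "nat \<Rightarrow> nat \<Rightarrow> (complex \<Rightarrow> complex) \<Rightarrow> complex \<Rightarrow> complex" where
  "weight M N \<rho> x = exp (- of_nat M * x / 2) * csqrt x ^ (M - N - 1) * inverse (\<rho> x)"

(* epsilon (x - y): plus or minus 1/2 according to the order of x and y along the contour. *)
definition eps_sgn :: "(real \<Rightarrow> complex) \<Rightarrow> complex \<Rightarrow> complex \<Rightarrow> complex" where
  "eps_sgn \<gamma> x y = of_real (sgn (the_inv_into {0..} \<gamma> x - the_inv_into {0..} \<gamma> y) / 2)"

definition eps_op :: "(real \<Rightarrow> complex) \<Rightarrow> (complex \<Rightarrow> complex) \<Rightarrow> complex \<Rightarrow> complex" where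
  "eps_op \<gamma> f x = contour_int \<gamma> (\<lambda>y. eps_sgn \<gamma> x y * f y)"

definition skew1 ::
  "(real \<Rightarrow> complex) \<Rightarrow> (complex \<Rightarrow> complex) \<Rightarrow> complex poly \<Rightarrow> complex poly \<Rightarrow> complex" where
  "skew1 \<gamma> w f g =
     contour_int \<gamma> (\<lambda>y. contour_int \<gamma> (\<lambda>x. eps_sgn \<gamma> x y * poly f x * poly g y * w x * w y))"

definition monic_of_degree :: "nat \<Rightarrow> complex poly \<Rightarrow> bool" where
  "monic_of_degree j p \<longleftrightarrow> degree p = j \<and> lead_coeff p = 1"

definition monic_laguerre ::
  "(real \<Rightarrow> complex) \<Rightarrow> nat \<Rightarrow> nat \<Rightarrow> (nat \<Rightarrow> complex poly) \<Rightarrow> (nat \<Rightarrow> complex) \<Rightarrow> bool" where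
  "monic_laguerre \<gamma> M N L h \<longleftrightarrow>
     (\<forall>j. monic_of_degree j (L j)) \<and>
     (\<forall>j k. contour_int \<gamma> (\<lambda>x. poly (L j) x * poly (L k) x * weight0 M N x)
              = (if j = k then h j else 0))"

(* For n = 2k and for n = 2k+1 alike, the orthogonality is to y^j with j < 2k. *)
definition skew_orthogonal ::
  "(real \<Rightarrow> complex) \<Rightarrow> (complex \<Rightarrow> complex) \<Rightarrow> nat \<Rightarrow> complex poly \<Rightarrow> bool" where
  "skew_orthogonal \<gamma> w n p \<longleftrightarrow>
     monic_of_degree n p \<and> (\<forall>j < 2 * (n div 2). skew1 \<gamma> w p (monom 1 j) = 0)"

definition moment_mat ::
  "(real \<Rightarrow> complex) \<Rightarrow> (complex \<Rightarrow> complex) \<Rightarrow> nat \<Rightarrow> (nat \<Rightarrow> complex poly) \<Rightarrow> complex mat" where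
  "moment_mat \<gamma> w N r = Matrix.mat N N (\<lambda>(j, k). skew1 \<gamma> w (r j) (r k))"

definition S1 ::
  "(real \<Rightarrow> complex) \<Rightarrow> (complex \<Rightarrow> complex) \<Rightarrow> nat \<Rightarrow> (nat \<Rightarrow> complex poly) \<Rightarrow>
   complex \<Rightarrow> complex \<Rightarrow> complex" where
  "S1 \<gamma> w N r x y =
     - (\<Sum>j<N. \<Sum>k<N. poly (r j) x * w x * (the (mat_inverse (moment_mat \<gamma> w N r)) $$ (j, k))
                         * eps_op \<gamma> (\<lambda>z. poly (r k) z * w z) y)"

(* (p(x) q(y) - p(y) q(x)) / (x - y), with its limit on the diagonal. *)
definition cd_quotient :: "complex poly \<Rightarrow> complex poly \<Rightarrow> complex \<Rightarrow> complex \<Rightarrow> complex" where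
  "cd_quotient p q x y =
     (if x = y then poly (pderiv p) x * poly q x - poly p x * poly (pderiv q) x
      else (poly p x * poly q y - poly p y * poly q x) / (x - y))"

lemma cd_quotient_diagonal:
  "((\<lambda>x. cd_quotient p q x y) \<longlongrightarrow> cd_quotient p q y y) (at y)"
proof -
  have "((\<lambda>x. poly p x * poly q y - poly p y * poly q x) has_field_derivative
          poly (pderiv p) y * poly q y - poly p y * poly (pderiv q) y) (at y)"
    by (auto intro!: derivative_eq_intros)
  then have "((\<lambda>x. (poly p x * poly q y - poly p y * poly q x) / (x - y)) \<longlongrightarrow>
          cd_quotient p q y y) (at y)"
    by (simp add: has_field_derivative_iff cd_quotient_def)
  then show ?thesis
    by (rule Lim_transform_eventually) (auto simp: cd_quotient_def eventually_at_filter)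
qed

(* The prefactor (y (t - ttau y) / (x (t - ttau x)))^(1/2) w0(x)^(1/2) w0(y)^(1/2) of the kernel
   is written as w(x) w0(y) / w(y), which fixes the branches and makes sense at x = 0 too;
   see the lemma below. *)
definition K2 ::
  "nat \<Rightarrow> nat \<Rightarrow> (complex \<Rightarrow> complex) \<Rightarrow> (nat \<Rightarrow> complex poly) \<Rightarrow> (nat \<Rightarrow> complex) \<Rightarrow>
   complex \<Rightarrow> complex \<Rightarrow> complex" where
  "K2 M N \<rho> L h x y =
     weight M N \<rho> x * weight0 M N y / weight M N \<rho> y *
     (cd_quotient (L N) (L (N - 1)) x y / h (N - 1))"

lemma K2_prefactor:
  assumes "N < M" "x \<noteq> 0" "y \<noteq> 0" "\<rho> x \<noteq> 0" "\<rho> y \<noteq> 0"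
  defines "w0_half \<equiv> \<lambda>z. csqrt z ^ (M - N) * exp (- of_nat M * z / 2)"
  shows "weight M N \<rho> x * weight0 M N y / weight M N \<rho> y
           = (csqrt y * \<rho> y) / (csqrt x * \<rho> x) * w0_half x * w0_half y"
    and "w0_half x ^ 2 = weight0 M N x"
proof -
  obtain k where k: "M - N = Suc k"
    using assms(1) by (metis Suc_diff_Suc)
  have e: "exp (- of_nat M * z) = exp (- of_nat M * z / 2) * exp (- of_nat M * z / 2)"
    for z :: complex
    by (simp add: mult.commute flip: exp_add)
  have s: "z ^ n = csqrt z ^ n * csqrt z ^ n" for z n
    by (metis power2_csqrt power2_eq_square power_mult_distrib)
  show "weight M N \<rho> x * weight0 M N y / weight M N \<rho> y
          = (csqrt y * \<rho> y) / (csqrt x * \<rho> x) * w0_half x * w0_half y"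
    unfolding weight_def weight0_def w0_half_def k s[of y "Suc k"] e[of y]
    using assms by (simp add: k field_simps)
  show "w0_half x ^ 2 = weight0 M N x"
    unfolding weight0_def w0_half_def s[of x "M - N"] e[of x] by (simp add: power2_eq_square)
qed

end

theory Submission
  imports Defs
    "Jordan_Normal_Form.Determinant"
    "HOL-Real_Asymp.Real_Asymp"
begin

text \<open>
  Write a for the constant ttau and A(x) = x (t - a x). The weights are tied together by
  w^2 A = w0, and the logarithmic derivative of w is rational with denominator A. Hence for every
  polynomial p there is a polynomial D p, of degree two higher, with (p A w)' = (D p) w. Since
  p A w vanishes at both ends of the contour, epsilon ((D p) w) = p A w (lemma eps_op_D), and
  therefore the skew form of f and D p is the Laguerre form: the integral of f p w0 (skew1_D).
  This turns every question about the skew form into one about the moment functional of w0.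

  The correction formula is an identity between kernels that are polynomial in both variables. Let
  K be the Christoffel-Darboux kernel of L_0, ..., L_(N-1). Pairing - D K(x, .) with f in the skew
  form gives f(x) for every f of degree below N, but D K(x, .) has degree up to N + 1. The coefficients
  of z^(N+1) and z^N are removed by adding suitable multiples of pi_(N+1) and pi_N, which pair to
  zero with everything of degree below N; those multiples are, up to sign, the entries of the two by
  two matrix in the statement (skew_kernel_below). The resulting polynomial Q(x, .) has degree
  below N and is a reproducing kernel of the skew form. Existence of a reproducing kernel forces the
  form to be nondegenerate, so the moment matrix is invertible, and its inverse must produce
  Q whatever monic basis r is used (inverse_of_moment_matrix). Applying epsilon in the second
  variable gives S_1 from Q, and K_2 from D K.

  Two points need an argument of their own. That pi_(N+1) is skew orthogonal to all polynomials
  of degree below N follows because such polynomials are spanned by the D p with p of degree at most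
  N - 3 together with L_(N-1) and L_(N-2): this is where the nonvanishing pairing of L_(N-1) with
  L_(N-2) enters (functional_zero). And the coefficient of z^N requires the subleading coefficient
  of L_n and the nonvanishing of the norms h_n on a complex contour; both come by induction from
  the Pearson equation of w0, without positivity or contour deformation (h_and_subleading).

  On the analytic side everything reduces to the fundamental theorem of calculus along the contour,
  plus Fubini's theorem for the antisymmetry of the skew form.
\<close>

section \<open>Polynomials of bounded degree and monic families\<close>

text \<open>The space of polynomials of degree less than n. A condition on coefficients, rather than on the
degree, makes it a linear space for every n: it contains 0, and is trivial for n = 0.\<close>

definition poly_below :: "nat \<Rightarrow> complex poly set" where
  "poly_below n = {f. \<forall>k\<ge>n. coeff f k = 0}"

lemma poly_below_0 [simp]: "0 \<in> poly_below n"
  by (simp add: poly_below_def)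

lemma poly_below_add: "f \<in> poly_below n \<Longrightarrow> g \<in> poly_below n \<Longrightarrow> f + g \<in> poly_below n"
  by (simp add: poly_below_def)

lemma poly_below_diff: "f \<in> poly_below n \<Longrightarrow> g \<in> poly_below n \<Longrightarrow> f - g \<in> poly_below n"
  by (simp add: poly_below_def)

lemma poly_below_smult: "f \<in> poly_below n \<Longrightarrow> Polynomial.smult c f \<in> poly_below n"
  by (simp add: poly_below_def)

lemma poly_below_minus: "f \<in> poly_below n \<Longrightarrow> - f \<in> poly_below n"
  by (simp add: poly_below_def)

lemma poly_below_sum: "(\<And>j. j \<in> A \<Longrightarrow> f j \<in> poly_below n) \<Longrightarrow> (\<Sum>j\<in>A. f j) \<in> poly_below n"
  by (simp add: poly_below_def coeff_sum)

lemma poly_below_mono: "f \<in> poly_below n \<Longrightarrow> n \<le> m \<Longrightarrow> f \<in> poly_below m"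
  by (simp add: poly_below_def)

lemma poly_below_pderiv: "f \<in> poly_below (Suc n) \<Longrightarrow> pderiv f \<in> poly_below n"
  by (simp add: poly_below_def coeff_pderiv)

lemma poly_below_pCons: "f \<in> poly_below n \<Longrightarrow> pCons a f \<in> poly_below (Suc n)"
  by (auto simp: poly_below_def coeff_pCons split: nat.split)

lemma poly_below_zero_iff: "f \<in> poly_below 0 \<longleftrightarrow> f = 0"
  by (auto simp: poly_below_def poly_eq_iff)

lemma poly_below_degree: "f \<in> poly_below (Suc (degree f))"
  by (simp add: poly_below_def coeff_eq_0)

lemma monic_of_degree_coeff:
  assumes "monic_of_degree n p"
  shows "coeff p n = 1" "k > n \<Longrightarrow> coeff p k = 0"
  using assms by (auto simp: monic_of_degree_def coeff_eq_0)

lemma monic_of_degree_below: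
  assumes "monic_of_degree n p" "n < k"
  shows "p \<in> poly_below k"
  using assms by (auto simp: poly_below_def monic_of_degree_coeff)

text \<open>The elimination step behind every induction on the degree below.\<close>

lemma poly_below_reduce:
  assumes "monic_of_degree n p" "f \<in> poly_below (Suc n)"
  shows "f - Polynomial.smult (coeff f n) p \<in> poly_below n"
proof -
  have "coeff (f - Polynomial.smult (coeff f n) p) k = 0" if "k \<ge> n" for k
    using assms that by (cases "k = n") (auto simp: poly_below_def monic_of_degree_coeff)
  then show ?thesis unfolding poly_below_def by blast
qed

lemma monic_family_spans:
  assumes "\<forall>j<n. monic_of_degree j (b j)" "f \<in> poly_below n"
  shows "\<exists>c. f = (\<Sum>j<n. Polynomial.smult (c j) (b j))"
  using assms
proof (induction n arbitrary: f)
  case 0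
  then show ?case by (simp add: poly_below_zero_iff)
next
  case (Suc n)
  have "f - Polynomial.smult (coeff f n) (b n) \<in> poly_below n"
    using Suc.prems by (intro poly_below_reduce) auto
  then obtain c where c: "f - Polynomial.smult (coeff f n) (b n)
      = (\<Sum>j<n. Polynomial.smult (c j) (b j))"
    using Suc.IH Suc.prems by auto
  have "f = (\<Sum>j<Suc n. Polynomial.smult ((c(n := coeff f n)) j) (b j))"
    using c by (simp add: algebra_simps)
  then show ?case by blast
qed

lemma monic_family_independent:
  assumes "\<forall>j<n. monic_of_degree j (b j)" "(\<Sum>j<n. Polynomial.smult (c j) (b j)) = 0"
  shows "\<forall>j<n. c j = 0"
  using assms
proof (induction n)
  case 0
  then show ?case by simp
next
  case (Suc n)
  have "coeff (b j) n = 0" if "j < n" for j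
    using Suc.prems(1) that by (intro monic_of_degree_coeff(2)) auto
  then have "coeff (\<Sum>j<Suc n. Polynomial.smult (c j) (b j)) n = c n"
    using Suc.prems(1) by (simp add: coeff_sum monic_of_degree_coeff)
  then have "c n = 0" unfolding Suc.prems(2) by simp
  then show ?case using Suc by (auto simp: less_Suc_eq)
qed

section \<open>Moment functionals with the Pearson equation of the Laguerre weight\<close>

text \<open>A linear functional that behaves like integration against x^\<alpha> exp (- m x). The equation called
pearson says that the functional kills ((x p) w0)' / w0; it is all that is used about the weight, besides
the nonzero total mass. No conjugation occurs, so the pairing of f and g is bilinear and nothing
like positivity is at hand: h n need not be real a priori.\<close>

locale laguerre_functional =
  fixes \<Lambda> :: "complex poly \<Rightarrow> complex" and \<alpha> :: nat and m :: complex
    and L :: "nat \<Rightarrow> complex poly" and h :: "nat \<Rightarrow> complex"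
  assumes \<Lambda>_add: "\<Lambda> (p + q) = \<Lambda> p + \<Lambda> q"
    and \<Lambda>_smult: "\<Lambda> (Polynomial.smult c p) = c * \<Lambda> p"
    and pearson: "\<Lambda> (Polynomial.smult (of_nat (Suc \<alpha>)) p + pCons 0 (pderiv p)
                     - Polynomial.smult m (pCons 0 p)) = 0"
    and m_nonzero: "m \<noteq> 0"
    and \<Lambda>_1: "\<Lambda> 1 \<noteq> 0"
    and L_monic: "monic_of_degree j (L j)"
    and L_orth: "\<Lambda> (L j * L k) = (if j = k then h j else 0)"
begin

lemma \<Lambda>_0 [simp]: "\<Lambda> 0 = 0"
  using \<Lambda>_smult[of 0 0] by simp

lemma \<Lambda>_diff: "\<Lambda> (p - q) = \<Lambda> p - \<Lambda> q"
  using \<Lambda>_add[of "p - q" q] by simp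

lemma \<Lambda>_sum: "\<Lambda> (\<Sum>j\<in>A. f j) = (\<Sum>j\<in>A. \<Lambda> (f j))"
  by (induction A rule: infinite_finite_induct) (auto simp: \<Lambda>_add)

lemma orth_below:
  assumes "f \<in> poly_below n"
  shows "\<Lambda> (L n * f) = 0"
proof -
  obtain c where "f = (\<Sum>j<n. Polynomial.smult (c j) (L j))"
    using monic_family_spans[of n L f] L_monic assms by auto
  then show ?thesis
    by (simp add: sum_distrib_left \<Lambda>_sum \<Lambda>_smult L_orth)
qed

lemma orth_top:
  assumes "f \<in> poly_below (Suc n)"
  shows "\<Lambda> (L n * f) = coeff f n * h n"
proof -
  have "\<Lambda> (L n * (f - Polynomial.smult (coeff f n) (L n))) = 0"
    by (intro orth_below poly_below_reduce L_monic assms)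
  then show ?thesis
    by (simp add: algebra_simps \<Lambda>_diff \<Lambda>_smult L_orth)
qed

lemma orth_top_commute:
  assumes "f \<in> poly_below (Suc n)"
  shows "\<Lambda> (f * L n) = coeff f n * h n"
  using orth_top[OF assms] by (simp add: mult.commute)

lemma coeff_L: "coeff (L n) n = 1" "k > n \<Longrightarrow> coeff (L n) k = 0"
  using monic_of_degree_coeff[OF L_monic] by auto

lemma L_below: "n < k \<Longrightarrow> L n \<in> poly_below k"
  using monic_of_degree_below[OF L_monic] .

lemma L_0: "L 0 = 1"
  using L_monic[of 0] by (metis degree_0_id monic_of_degree_def one_pCons degree_eq_zeroE lead_coeff_pCons(2) coeff_pCons_0)

text \<open>The coefficient of x^(n-1) in L n, with value 0 for n = 0; multiplying by x avoids a case
distinction.\<close>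

definition subleading :: "nat \<Rightarrow> complex" where
  "subleading n = coeff (pCons 0 (L n)) n"

lemma subleading_simps [simp]: "subleading 0 = 0" "subleading (Suc n) = coeff (L (Suc n)) n"
  by (simp_all add: subleading_def)

lemma shift_below: "pCons 0 (L n) - L (Suc n) \<in> poly_below (Suc n)"
proof -
  have "coeff (pCons 0 (L n) - L (Suc n)) k = 0" if "k \<ge> Suc n" for k
    using that by (cases k) (auto simp: coeff_L le_less)
  then show ?thesis unfolding poly_below_def by blast
qed

lemma moment_shift_square: "\<Lambda> (pCons 0 (L n) * L n) = (subleading n - subleading (Suc n)) * h n"
proof -
  have "\<Lambda> ((pCons 0 (L n) - L (Suc n)) * L n) = (subleading n - subleading (Suc n)) * h n"
    using orth_top_commute[OF shift_below] by (simp add: subleading_def)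
  then show ?thesis
    by (simp add: left_diff_distrib \<Lambda>_diff L_orth)
qed

lemma moment_shift_Suc: "\<Lambda> (pCons 0 (L n) * L (Suc n)) = h (Suc n)"
  using orth_top_commute[of "pCons 0 (L n)" "Suc n"] poly_below_pCons[OF L_below[of n "Suc n"]]
  by (simp add: coeff_L)

lemma euler_below: "pCons 0 (pderiv (L n)) \<in> poly_below (Suc n)"
  by (intro poly_below_pCons poly_below_pderiv L_below) simp

lemma coeff_euler: "coeff (pCons 0 (pderiv p)) n = of_nat n * coeff p n"
  by (cases n) (auto simp: coeff_pderiv)

lemma pCons_0_mult: "pCons 0 p * q = pCons 0 (p * q)" "p * pCons 0 q = pCons 0 (p * q)"
  for p q :: "complex poly"
  by simp_all

text \<open>Computes the integral of x (L n)^2 w0 in two ways: by multiplication by x, which raises the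
degree and compares subleading coefficients, and by the Pearson equation for (L n)^2, in which
the Euler operator x d/dx acts on the leading term as multiplication by n.\<close>

lemma subleading_step:
  assumes "h n \<noteq> 0"
  shows "m * (subleading n - subleading (Suc n)) = of_nat (2 * n + \<alpha> + 1)"
proof -
  have "pCons 0 (pderiv (L n * L n)) = pCons 0 (pderiv (L n)) * L n + pCons 0 (pderiv (L n)) * L n"
    by (simp add: pderiv_mult)
  then have "of_nat (Suc \<alpha>) * h n + (of_nat n * h n + of_nat n * h n)
      = m * ((subleading n - subleading (Suc n)) * h n)"
    using pearson[of "L n * L n"] orth_top_commute[OF euler_below[of n]] moment_shift_square[of n]
    by (simp only: \<Lambda>_diff \<Lambda>_add \<Lambda>_smult L_orth coeff_euler coeff_L pCons_0_mult if_True refl) simp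
  then have "(m * (subleading n - subleading (Suc n))) * h n = of_nat (2 * n + \<alpha> + 1) * h n"
    by (simp add: algebra_simps)
  then show ?thesis using assms by simp
qed

text \<open>Now the Pearson equation for L (n+1) L n. The Euler operator maps L (n+1) to (n+1) L (n+1) plus a
polynomial of degree n with leading coefficient minus the subleading coefficient of L (n+1).\<close>

lemma h_step: "m * h (Suc n) = - subleading (Suc n) * h n"
proof -
  let ?p = "pCons 0 (pderiv (L (Suc n))) - Polynomial.smult (of_nat (Suc n)) (L (Suc n))"
  have "?p \<in> poly_below (Suc n)"
    using poly_below_reduce[OF L_monic euler_below, of "Suc n"] by (simp only: coeff_euler coeff_L) simp
  from orth_top_commute[OF this]
  moreover have "coeff ?p n = - subleading (Suc n)"
    by (simp add: coeff_euler algebra_simps)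
  ultimately have "\<Lambda> (?p * L n) = - subleading (Suc n) * h n"
    by simp
  then have 1: "\<Lambda> (pCons 0 (pderiv (L (Suc n))) * L n) = - subleading (Suc n) * h n"
    by (simp add: left_diff_distrib \<Lambda>_diff \<Lambda>_smult L_orth del: of_nat_Suc)
  have 2: "\<Lambda> (L (Suc n) * pCons 0 (pderiv (L n))) = 0"
    by (rule orth_below[OF euler_below])
  have "pCons 0 (pderiv (L (Suc n) * L n))
      = pCons 0 (pderiv (L (Suc n))) * L n + L (Suc n) * pCons 0 (pderiv (L n))"
    by (simp add: pderiv_mult algebra_simps)
  then have 3: "\<Lambda> (pCons 0 (pderiv (L (Suc n) * L n))) = - subleading (Suc n) * h n"
    by (simp only: \<Lambda>_add 1 2) simp
  have "\<Lambda> (pCons 0 (L (Suc n) * L n)) = h (Suc n)"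
    using moment_shift_Suc[of n] by (simp add: mult.commute)
  then show ?thesis
    using pearson[of "L (Suc n) * L n"] 3 by (simp only: \<Lambda>_diff \<Lambda>_add \<Lambda>_smult L_orth) simp
qed

text \<open>The two steps feed each other: a nonzero h n determines the next subleading coefficient, which
is nonzero and hence makes h (n+1) nonzero. In the end h (n+1) / h n = (n+1) (n+1+\<alpha>) / m^2.\<close>

lemma h_and_subleading: "h n \<noteq> 0 \<and> m * subleading n = - of_nat (n * (n + \<alpha>))"
proof (induction n)
  case 0
  show ?case using L_orth[of 0 0] \<Lambda>_1 by (simp add: L_0)
next
  case (Suc n)
  have "m * subleading (Suc n) = m * subleading n - m * (subleading n - subleading (Suc n))"
    by (simp add: algebra_simps)
  also have "\<dots> = - of_nat (Suc n * (Suc n + \<alpha>))"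
    using Suc subleading_step[of n] by (simp only:) (simp add: algebra_simps)
  finally have s: "m * subleading (Suc n) = - of_nat (Suc n * (Suc n + \<alpha>))" .
  then have "subleading (Suc n) \<noteq> 0" by (metis mult_zero_right neg_equal_0_iff_equal of_nat_eq_0_iff mult_is_0 add_is_0 nat.distinct(1))
  then have "m * h (Suc n) \<noteq> 0" using Suc unfolding h_step by simp
  then show ?case using s by simp
qed

lemma h_nonzero: "h n \<noteq> 0" and m_subleading: "m * subleading n = - of_nat (n * (n + \<alpha>))"
  using h_and_subleading by auto

lemma below_orth_zero:
  assumes "f \<in> poly_below n" "\<And>k. k < n \<Longrightarrow> \<Lambda> (L k * f) = 0"
  shows "f = 0"
proof (rule ccontr)
  assume "f \<noteq> 0"
  have "degree f < n"
  proof (rule ccontr)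
    assume "\<not> degree f < n"
    then have "lead_coeff f = 0"
      using assms(1) unfolding poly_below_def by auto
    then show False using \<open>f \<noteq> 0\<close> by simp
  qed
  then have "lead_coeff f * h (degree f) = 0"
    using assms(2)[of "degree f"] orth_top[OF poly_below_degree[of f]] by simp
  then show False using \<open>f \<noteq> 0\<close> h_nonzero by simp
qed

text \<open>The difference of the two sides has degree at most n and is orthogonal to all
polynomials of degree at most n.\<close>

lemma three_term:
  "L (Suc (Suc n)) = pCons 0 (L (Suc n)) - Polynomial.smult (subleading (Suc n) - subleading (Suc (Suc n))) (L (Suc n))
     - Polynomial.smult (h (Suc n) / h n) (L n)"
proof -
  let ?g = "pCons 0 (L (Suc n)) - L (Suc (Suc n))"
  let ?f = "?g - Polynomial.smult (subleading (Suc n) - subleading (Suc (Suc n))) (L (Suc n))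
     - Polynomial.smult (h (Suc n) / h n) (L n)"
  have c: "coeff ?g (Suc n) = subleading (Suc n) - subleading (Suc (Suc n))"
    by (simp add: subleading_def)
  have "?g - Polynomial.smult (coeff ?g (Suc n)) (L (Suc n)) \<in> poly_below (Suc n)"
    by (rule poly_below_reduce[OF L_monic shift_below])
  from poly_below_diff[OF this poly_below_smult[OF L_below[OF lessI]]]
  have below: "?f \<in> poly_below (Suc n)"
    unfolding c .
  have "\<Lambda> (L k * ?f) = 0" if "k < Suc n" for k
  proof -
    have shift: "L k * pCons 0 (L (Suc n)) = pCons 0 (L k) * L (Suc n)"
      by simp
    have "\<Lambda> (pCons 0 (L k) * L (Suc n)) = (if k = n then h (Suc n) else 0)"
      using orth_top_commute[of "pCons 0 (L k)" "Suc n"] poly_below_pCons[OF L_below[of k "Suc n"]]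
        that by (simp add: coeff_L)
    then show ?thesis
      using that h_nonzero[of n]
      unfolding right_diff_distrib \<Lambda>_diff mult_smult_right \<Lambda>_smult L_orth shift
      by (auto simp del: subleading_simps)
  qed
  from below_orth_zero[OF below this] show ?thesis by (simp add: algebra_simps)
qed

definition cd_kernel :: "nat \<Rightarrow> complex \<Rightarrow> complex poly" where
  "cd_kernel n x = (\<Sum>j<n. Polynomial.smult (poly (L j) x / h j) (L j))"

lemma cd_kernel_reproducing:
  assumes "f \<in> poly_below n"
  shows "\<Lambda> (f * cd_kernel n x) = poly f x"
proof -
  obtain c where c: "f = (\<Sum>j<n. Polynomial.smult (c j) (L j))"
    using monic_family_spans[of n L f] L_monic assms by auto
  have *: "\<Lambda> (L k * cd_kernel n x) = poly (L k) x" if "k < n" for k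
  proof -
    have "\<Lambda> (L k * cd_kernel n x) = (\<Sum>j<n. poly (L j) x / h j * (if k = j then h k else 0))"
      by (simp add: cd_kernel_def sum_distrib_left \<Lambda>_sum \<Lambda>_smult L_orth)
    also have "\<dots> = (\<Sum>j<n. if k = j then poly (L k) x else 0)"
      by (intro sum.cong) (auto simp: h_nonzero)
    finally show ?thesis using that by simp
  qed
  have "\<Lambda> (f * cd_kernel n x) = (\<Sum>j<n. c j * \<Lambda> (L j * cd_kernel n x))"
    by (simp add: c sum_distrib_right \<Lambda>_sum \<Lambda>_smult)
  also have "\<dots> = poly f x"
    unfolding c poly_sum by (intro sum.cong) (auto simp: *)
  finally show ?thesis .
qed

lemma christoffel_darboux:
  "(x - y) * poly (cd_kernel (Suc n) x) y * h n
     = poly (L (Suc n)) x * poly (L n) y - poly (L (Suc n)) y * poly (L n) x"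
proof (induction n)
  case 0
  have "L (Suc 0) - pCons 0 (L 0) \<in> poly_below 1"
    using poly_below_minus[OF shift_below[of 0]] by simp
  then obtain c where "L (Suc 0) - pCons 0 (L 0) = Polynomial.smult c (L 0)"
    using monic_family_spans[of 1 L "L (Suc 0) - pCons 0 (L 0)"] L_monic by auto
  then have "L (Suc 0) = [:c, 1:]"
    by (simp add: L_0 algebra_simps one_pCons)
  then show ?case using h_nonzero[of 0] by (simp add: cd_kernel_def L_0)
next
  case (Suc n)
  have k: "poly (cd_kernel (Suc (Suc n)) x) y
      = poly (cd_kernel (Suc n) x) y + poly (L (Suc n)) x * poly (L (Suc n)) y / h (Suc n)"
    by (simp add: cd_kernel_def poly_sum)
  have "(x - y) * poly (cd_kernel (Suc (Suc n)) x) y * h (Suc n)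
      = (x - y) * poly (cd_kernel (Suc n) x) y * h n * (h (Suc n) / h n)
        + (x - y) * poly (L (Suc n)) x * poly (L (Suc n)) y"
    unfolding k using h_nonzero[of n] h_nonzero[of "Suc n"] by (simp add: field_simps)
  also have "\<dots> = poly (L (Suc (Suc n))) x * poly (L (Suc n)) y
      - poly (L (Suc (Suc n))) y * poly (L (Suc n)) x"
    unfolding Suc.IH three_term[of n] by (simp add: algebra_simps del: subleading_simps)
  finally show ?case .
qed

text \<open>Off the diagonal this is the Christoffel-Darboux formula; on the diagonal both sides are limits
of the off-diagonal values.\<close>

lemma cd_kernel_eq_cd_quotient:
  "poly (cd_kernel (Suc n) x) y = cd_quotient (L (Suc n)) (L n) x y / h n"
proof -
  have off: "poly (cd_kernel (Suc n) x) y = cd_quotient (L (Suc n)) (L n) x y / h n" if "x \<noteq> y" for x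
    using christoffel_darboux[of x y n] that h_nonzero[of n]
    by (simp add: cd_quotient_def field_simps)
  show ?thesis
  proof (cases "x = y")
    case True
    have "((\<lambda>x. poly (cd_kernel (Suc n) x) y) \<longlongrightarrow> poly (cd_kernel (Suc n) y) y) (at y)"
      unfolding cd_kernel_def poly_sum poly_smult using h_nonzero by (auto intro!: tendsto_eq_intros)
    moreover have "((\<lambda>x. poly (cd_kernel (Suc n) x) y) \<longlongrightarrow> cd_quotient (L (Suc n)) (L n) y y / h n) (at y)"
      by (rule Lim_transform_eventually[OF tendsto_divide[OF cd_quotient_diagonal tendsto_const h_nonzero]])
        (auto simp: eventually_at_filter off)
    ultimately show ?thesis using True by (metis tendsto_unique at_neq_bot)
  qed (rule off)
qed

end

section \<open>The reproducing kernel of the skew form\<close>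

text \<open>The algebra of the skew form B. In the application n = N - 2, D p is the polynomial with
(p A w)' = (D p) w for A(x) = x (t - a x), and B_D is integration by parts. The value of m makes the
number \<alpha> + N equal to m, as for \<alpha> = M - N and m = M.\<close>

locale skew_laguerre = laguerre_functional \<Lambda> \<alpha> m L h
  for \<Lambda> \<alpha> m L h +
  fixes a t :: complex and n :: nat
    and B :: "complex poly \<Rightarrow> complex poly \<Rightarrow> complex"
  fixes D :: "complex poly \<Rightarrow> complex poly"
  defines "D \<equiv> \<lambda>p. pCons 0 ([:t, -a:] * pderiv p)
      + [: t * (of_nat \<alpha> + 1) / 2, - (a + a * of_nat \<alpha> / 2 + m * t / 2), a * m / 2 :] * p"
  assumes a_nonzero: "a \<noteq> 0"
    and m_eq: "m = of_nat (\<alpha> + n + 2)"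
    and B_add: "B (f + g) k = B f k + B g k"
    and B_smult: "B (Polynomial.smult c f) k = c * B f k"
    and B_skew: "B f g = - B g f"
    and B_D: "B (D p) f = - \<Lambda> (f * p)"
    and B_L_nonzero: "B (L (Suc n)) (L n) \<noteq> 0"
begin

lemma B_add_right: "B k (f + g) = B k f + B k g"
  using B_add[of f g k] B_skew by (metis minus_add_distrib)

lemma B_smult_right: "B k (Polynomial.smult c f) = c * B k f"
  using B_smult[of c f k] B_skew by (metis mult_minus_right)

lemma B_diff: "B (f - g) k = B f k - B g k"
  using B_add[of "f - g" g k] by simp

lemma B_minus: "B (- f) k = - B f k"
  using B_smult[of "-1" f k] by simp

lemma B_diag: "B f f = 0"
proof -
  have "2 * B f f = 0" using B_skew[of f f] by (metis mult_2 add.right_inverse)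
  then show ?thesis by simp
qed

lemma B_D_right: "B f (D p) = \<Lambda> (f * p)"
  using B_D B_skew by (metis add.inverse_inverse)

lemma D_add: "D (p + q) = D p + D q"
proof -
  have "pCons 0 (u + v) = pCons 0 u + pCons 0 v" for u v :: "complex poly" by simp
  then show ?thesis unfolding D_def pderiv_add distrib_left by (simp only: ac_simps)
qed

lemma D_smult: "D (Polynomial.smult c p) = Polynomial.smult c (D p)"
proof -
  have "pCons 0 (Polynomial.smult c u) = Polynomial.smult c (pCons 0 u)" for u by simp
  then show ?thesis
    unfolding D_def pderiv_smult mult_smult_right smult_add_right by (simp only:)
qed

lemma coeff_D:
  "coeff (D p) (Suc (Suc k)) = a * m / 2 * coeff p k
     - (a + a * of_nat \<alpha> / 2 + m * t / 2 + a * of_nat (Suc k)) * coeff p (Suc k)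
     + t * (of_nat (k + 2) + (of_nat \<alpha> + 1) / 2) * coeff p (Suc (Suc k))"
  by (simp add: D_def coeff_pderiv field_simps)

lemma D_below: "p \<in> poly_below k \<Longrightarrow> D p \<in> poly_below (Suc (Suc k))"
  unfolding poly_below_def
proof (safe)
  fix i assume "\<forall>j\<ge>k. coeff p j = 0" "Suc (Suc k) \<le> i"
  moreover have "i = Suc (Suc (i - 2))"
    using \<open>Suc (Suc k) \<le> i\<close> by simp
  then obtain i' where "i = Suc (Suc i')" ..
  ultimately show "coeff (D p) i = 0" by (simp add: coeff_D)
qed

lemma D_leading_nonzero: "a * m / 2 \<noteq> 0"
  using a_nonzero m_nonzero by simp

text \<open>D raises the degree by exactly two, so its range is complemented by the polynomials of degree at
most one.\<close>

lemma D_reduce: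
  "f \<in> poly_below (Suc (Suc k)) \<Longrightarrow> \<exists>p\<in>poly_below k. \<exists>c d. f = D p + [:c, d:]"
proof (induction k arbitrary: f)
  case 0
  have "f = D 0 + [:coeff f 0, coeff f 1:]"
  proof (rule poly_eqI)
    fix i show "coeff f i = coeff (D 0 + [:coeff f 0, coeff f 1:]) i"
      using 0 by (cases i; cases "i - 1") (auto simp: D_def poly_below_def)
  qed
  then show ?case using poly_below_0 by blast
next
  case (Suc k)
  define e where "e = coeff f (Suc (Suc k)) / (a * m / 2)"
  let ?p = "Polynomial.smult e (monom 1 k)"
  have p: "?p \<in> poly_below (Suc k)" by (simp add: poly_below_def)
  have "coeff (f - D ?p) i = 0" if "i \<ge> Suc (Suc k)" for i
  proof (cases "i = Suc (Suc k)")
    case True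
    then show ?thesis using D_leading_nonzero by (simp add: coeff_D e_def)
  next
    case False
    then show ?thesis
      using that Suc.prems D_below[OF p] by (simp add: poly_below_def)
  qed
  then have "f - D ?p \<in> poly_below (Suc (Suc k))" unfolding poly_below_def by blast
  from Suc.IH[OF this] obtain q c d where q: "q \<in> poly_below k" "f - D ?p = D q + [:c, d:]"
    by blast
  then have "f = D (?p + q) + [:c, d:]" by (simp add: D_add algebra_simps)
  moreover have "?p + q \<in> poly_below (Suc k)"
    by (intro poly_below_add p poly_below_mono[OF q(1)]) simp
  ultimately show ?case by blast
qed

text \<open>The polynomials D p with p of degree less than n, together with L n and L (n+1), span all
polynomials of degree less than n+2. By D_reduce it is enough that the remainders of L n and L (n+1)
modulo the range of D are linearly independent. A dependence would put a nontrivial combination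
u L n + v L (n+1) into the range; being D q with q of degree less than n, it would pair to zero
with L n and L (n+1), which contradicts the nonzero pairing of those two.\<close>

lemma functional_zero:
  assumes add: "\<And>f g. \<phi> (f + g) = \<phi> f + \<phi> g"
    and smult: "\<And>c f. \<phi> (Polynomial.smult c f) = c * (\<phi> f :: complex)"
    and D: "\<And>p. p \<in> poly_below n \<Longrightarrow> \<phi> (D p) = 0"
    and L: "\<phi> (L n) = 0" "\<phi> (L (Suc n)) = 0"
    and f: "f \<in> poly_below (Suc (Suc n))"
  shows "\<phi> f = 0"
proof -
  have lin: "\<phi> [:c, d:] = c * \<phi> 1 + d * \<phi> [:0, 1:]" for c d
    using add[of "Polynomial.smult c 1" "Polynomial.smult d [:0, 1:]"]
    unfolding smult by (simp add: one_pCons)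
  obtain p c d where 0: "p \<in> poly_below n" "L n = D p + [:c, d:]"
    using D_reduce[of "L n" n] L_below[of n "Suc (Suc n)"] by auto
  obtain p' c' d' where 1: "p' \<in> poly_below n" "L (Suc n) = D p' + [:c', d':]"
    using D_reduce[of "L (Suc n)" n] L_below[of "Suc n" "Suc (Suc n)"] by auto
  have not_D: False
    if "D q = Polynomial.smult u (L n) + Polynomial.smult v (L (Suc n))" "q \<in> poly_below n"
      "u \<noteq> 0 \<or> v \<noteq> 0" for q u v
  proof -
    have "B (D q) (L n) = 0" "B (D q) (L (Suc n)) = 0"
      using orth_below[OF that(2)] orth_below[OF poly_below_mono[OF that(2), of "Suc n"]]
      by (simp_all add: B_D)
    then have "v * B (L (Suc n)) (L n) = 0" "u * B (L n) (L (Suc n)) = 0"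
      unfolding that(1) B_add B_smult B_diag by simp_all
    then show False using that(3) B_L_nonzero B_skew[of "L n" "L (Suc n)"] by auto
  qed
  \<comment> \<open>A vanishing determinant yields dependences with coefficients (c', -c) and (d', -d), and all four
numbers vanish; then already L n lies in the range of D.\<close>
  have det: "c * d' \<noteq> c' * d"
  proof
    assume det0: "c * d' = c' * d"
    have comb: "D (Polynomial.smult u p + Polynomial.smult v p')
        = Polynomial.smult u (L n) + Polynomial.smult v (L (Suc n))
          - [:u * c + v * c', u * d + v * d':]" for u v
      unfolding 0(2) 1(2) D_add D_smult by (simp add: smult_add_right)
    have in_below: "Polynomial.smult u p + Polynomial.smult v p' \<in> poly_below n" for u v
      by (intro poly_below_add poly_below_smult 0 1)
    have "c = 0" "c' = 0"
      using not_D[OF _ in_below, of c' "-c" c' "-c"] comb[of c' "-c"] det0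
      by (auto simp: mult.commute)
    moreover have "d = 0" "d' = 0"
      using not_D[OF _ in_below, of d' "-d" d' "-d"] comb[of d' "-d"] det0
      by (auto simp: mult.commute)
    ultimately show False using not_D[of p 1 0] 0 by simp
  qed
  have \<phi>_reduced: "\<phi> (D q + [:u, v:]) = u * \<phi> 1 + v * \<phi> [:0, 1:]"
    if "q \<in> poly_below n" for q u v
    using add[of "D q" "[:u, v:]"] D[OF that] lin[of u v] by simp
  have eqs: "c * \<phi> 1 + d * \<phi> [:0, 1:] = 0" "c' * \<phi> 1 + d' * \<phi> [:0, 1:] = 0"
    using L \<phi>_reduced[OF 0(1), of c d] \<phi>_reduced[OF 1(1), of c' d'] 0(2) 1(2) by auto
  have "(c * d' - c' * d) * \<phi> 1
      = d' * (c * \<phi> 1 + d * \<phi> [:0, 1:]) - d * (c' * \<phi> 1 + d' * \<phi> [:0, 1:])"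
    "(c * d' - c' * d) * \<phi> [:0, 1:]
      = c * (c' * \<phi> 1 + d' * \<phi> [:0, 1:]) - c' * (c * \<phi> 1 + d * \<phi> [:0, 1:])"
    by (simp_all add: algebra_simps)
  then have "(c * d' - c' * d) * \<phi> 1 = 0" "(c * d' - c' * d) * \<phi> [:0, 1:] = 0"
    unfolding eqs by simp_all
  then have "\<phi> 1 = 0" "\<phi> [:0, 1:] = 0" using det by simp_all
  moreover obtain q e e' where "q \<in> poly_below n" "f = D q + [:e, e':]"
    using D_reduce[OF f] by auto
  ultimately show ?thesis using \<phi>_reduced[of q e e'] by simp
qed

text \<open>The polynomial called pi_(N+1) in the theorem, for N = n + 2.\<close>

definition pi_top :: "complex poly" where
  "pi_top = L (n + 3)
     - Polynomial.smult (B (L (n + 3)) (L n) / B (L (Suc n)) (L n)) (L (Suc n))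
     + Polynomial.smult (B (L (n + 3)) (L (Suc n)) / B (L (Suc n)) (L n)) (L n)"

lemma pi_top_skew_orthogonal:
  assumes "f \<in> poly_below (Suc (Suc n))"
  shows "B pi_top f = 0"
proof (rule functional_zero[of "B pi_top", OF B_add_right B_smult_right _ _ _ assms])
  show "B pi_top (D p) = 0" if "p \<in> poly_below n" for p
    unfolding pi_top_def B_D_right
    using orth_below[OF that] orth_below[OF poly_below_mono[OF that, of "Suc n"]]
      orth_below[OF poly_below_mono[OF that, of "n + 3"]]
    by (simp add: left_diff_distrib distrib_right \<Lambda>_add \<Lambda>_diff \<Lambda>_smult)
  show "B pi_top (L n) = 0" "B pi_top (L (Suc n)) = 0"
    unfolding pi_top_def B_add B_diff B_smult B_diag
    using B_L_nonzero B_skew[of "L n" "L (Suc n)"] by simp_all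
qed

text \<open>Here q stands for pi_N. The multiples of pi_top and q are the ones that cancel the coefficients of
degrees n+3 and n+2 in D (cd_kernel (n + 2) x).\<close>

definition skew_kernel :: "complex poly \<Rightarrow> complex \<Rightarrow> complex poly" where
  "skew_kernel q x = - D (cd_kernel (n + 2) x)
     + Polynomial.smult (m * a / (2 * h (Suc n)) * poly (L (Suc n)) x) pi_top
     + Polynomial.smult (m * a / (2 * h n) * poly (L n) x
         - (m * t - a * (m + of_nat (n + 2))) / (2 * h (Suc n)) * poly (L (Suc n)) x) q"

lemma skew_kernel_reproducing:
  assumes "f \<in> poly_below (n + 2)" "B q f = 0"
  shows "B (skew_kernel q x) f = poly f x"
  using assms pi_top_skew_orthogonal[of f] cd_kernel_reproducing[OF assms(1), of x]
  by (simp add: skew_kernel_def B_add B_diff B_minus B_smult B_D)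

text \<open>Only the last two summands of the Christoffel-Darboux kernel produce degrees above n+1. For L n one
compares leading coefficients. For L (n+1) the coefficient of degree n+2 also has to cancel, which
involves the difference of the subleading coefficients of L (n+3) and L (n+1): multiplied by m
it is - (4 n + 8 + 2 \<alpha>) = - 2 (m + n + 2), which accounts for the term a (m + N).\<close>

lemma skew_kernel_below:
  assumes q: "monic_of_degree (n + 2) q"
  shows "skew_kernel q x \<in> poly_below (n + 2)"
proof -
  define c where "c = (m * t - a * (m + of_nat (n + 2))) / 2"
  let ?f = "Polynomial.smult (m * a / 2) q - D (L n)"
  let ?g = "Polynomial.smult (m * a / 2) pi_top - Polynomial.smult c q - D (L (Suc n))"
  have K: "cd_kernel (n + 2) x = cd_kernel n x + Polynomial.smult (poly (L n) x / h n) (L n)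
      + Polynomial.smult (poly (L (Suc n)) x / h (Suc n)) (L (Suc n))"
    by (simp add: cd_kernel_def)
  have eq: "skew_kernel q x = - D (cd_kernel n x) + Polynomial.smult (poly (L n) x / h n) ?f
      + Polynomial.smult (poly (L (Suc n)) x / h (Suc n)) ?g"
    unfolding skew_kernel_def K D_add D_smult c_def
    by (rule poly_eqI) (simp add: field_simps h_nonzero)
  have q0: "coeff q k = (if k = n + 2 then 1 else 0)" if "k \<ge> n + 2" for k
    using monic_of_degree_coeff[OF q] that by simp
  have "coeff ?f k = 0" if "k \<ge> n + 2" for k
  proof -
    obtain k' where k': "k = Suc (Suc k')" "k' \<ge> n"
      using \<open>k \<ge> n + 2\<close> by (intro that[of "k - 2"]) auto
    show ?thesis
      using q0[OF that] k' by (cases "k' = n") (simp_all add: coeff_D coeff_L algebra_simps)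
  qed
  then have f: "?f \<in> poly_below (n + 2)" unfolding poly_below_def by blast
  have top: "coeff pi_top k = coeff (L (n + 3)) k" if "k \<ge> n + 2" for k
    using that by (simp add: pi_top_def coeff_L)
  have sub: "m * coeff (L (n + 3)) (n + 2) = - of_nat ((n + 3) * (n + 3 + \<alpha>))"
    "m * coeff (L (Suc n)) n = - of_nat ((n + 1) * (n + 1 + \<alpha>))"
    using m_subleading[of "n + 3"] m_subleading[of "n + 1"] by (simp_all add: numeral_3_eq_3)
  have "coeff ?g k = 0" if "k \<ge> n + 2" for k
  proof -
    obtain k' where k': "k = Suc (Suc k')" "k' \<ge> n"
      using \<open>k \<ge> n + 2\<close> by (intro that[of "k - 2"]) auto
    consider "k' = n" | "k' = Suc n" | "k' > Suc n" using k' by linarith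
    then show ?thesis
    proof cases
      case 1
      have "coeff ?g k = m * coeff (L (n + 3)) (n + 2) * a / 2 - c
          - (m * coeff (L (Suc n)) n * a / 2
             - (a + a * of_nat \<alpha> / 2 + m * t / 2 + a * of_nat (Suc n)))"
        using q0[OF that] top[OF that] k' 1 by (simp add: coeff_D coeff_L algebra_simps)
      also have "\<dots> = 0"
        unfolding sub c_def by (simp add: m_eq field_simps)
      finally show ?thesis .
    next
      case 2
      then have "k = n + 3" using k' by simp
      then have "coeff (L (n + 3)) k = 1" by (simp only: coeff_L(1))
      then show ?thesis
        using q0[OF that] top[OF that] k' 2 by (simp add: coeff_D coeff_L algebra_simps)
    next
      case 3
      then have "k > n + 3" using k' by simp
      then show ?thesis
        using q0[OF that] top[OF that] k' 3 by (simp add: coeff_D coeff_L)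
    qed
  qed
  then have g: "?g \<in> poly_below (n + 2)" unfolding poly_below_def by blast
  have "cd_kernel n x \<in> poly_below n"
    unfolding cd_kernel_def by (intro poly_below_sum poly_below_smult L_below) simp
  then show ?thesis
    unfolding eq using D_below
    by (intro poly_below_add poly_below_minus poly_below_smult f g) simp
qed

end

section \<open>Inverting the moment matrix\<close>

text \<open>A reproducing kernel Q shows nondegeneracy: if f pairs to zero with everything, then f(x), the
pairing of Q x with f, is zero for all x. Expanding Q x in the basis r, the
reproducing property for the basis vectors is a linear system for the coefficients whose solution
is given by the inverse matrix.\<close>

lemma inverse_of_moment_matrix:
  fixes B :: "complex poly \<Rightarrow> complex poly \<Rightarrow> complex"
  assumes add_left: "\<And>f g k. B (f + g) k = B f k + B g k"
    and smult_left: "\<And>c f k. B (Polynomial.smult c f) k = c * B f k"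
    and skew: "\<And>f g. B f g = - B g f"
    and r: "\<forall>j<N. monic_of_degree j (r j)"
    and Q_below: "\<And>x. Q x \<in> poly_below N"
    and Q: "\<And>f x. f \<in> poly_below N \<Longrightarrow> B (Q x) f = poly f x"
  defines "A \<equiv> Matrix.mat N N (\<lambda>(j, k). B (r j) (r k))"
  shows "invertible_mat A"
    and "Q x = (\<Sum>j<N. \<Sum>k<N. Polynomial.smult (poly (r j) x * (the (mat_inverse A) $$ (j, k))) (r k))"
proof -
  have B_0: "B 0 g = 0" for g using smult_left[of 0 0 g] by simp
  have sum_left: "B (\<Sum>j\<in>S. f j) g = (\<Sum>j\<in>S. B (f j) g)" for S :: "nat set" and f g
    by (induction S rule: infinite_finite_induct) (auto simp: add_left B_0)
  have sum_right: "B g (\<Sum>j\<in>S. f j) = (\<Sum>j\<in>S. B g (f j))" for S :: "nat set" and f g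
    by (simp only: skew[of g] sum_left sum_negf)
  have smult_right: "B g (Polynomial.smult c f) = c * B g f" for g c f
    by (simp only: skew[of g] smult_left mult_minus_right)
  have r_below: "r j \<in> poly_below N" if "j < N" for j
    using r that by (auto intro: monic_of_degree_below)
  have A: "A \<in> carrier_mat N N" by (simp add: A_def)
  have "Determinant.det A \<noteq> 0"
  proof
    assume "Determinant.det A = 0"
    then obtain v where v: "v \<in> carrier_vec N" "v \<noteq> 0\<^sub>v N" "A *\<^sub>v v = 0\<^sub>v N"
      using det_0_iff_vec_prod_zero_field[OF A] by auto
    define f where "f = (\<Sum>l<N. Polynomial.smult (v $ l) (r l))"
    have f_below: "f \<in> poly_below N"
      unfolding f_def by (intro poly_below_sum poly_below_smult r_below) simp
    have row: "B (r k) f = 0" if "k < N" for k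
    proof -
      have "B (r k) f = (A *\<^sub>v v) $ k"
        using that v(1)
        by (simp add: A_def f_def sum_right smult_right scalar_prod_def mult.commute
            lessThan_atLeast0)
      then show ?thesis using v(3) that by simp
    qed
    have "poly f x = 0" for x
    proof -
      obtain c where c: "Q x = (\<Sum>j<N. Polynomial.smult (c j) (r j))"
        using monic_family_spans[OF r Q_below] by blast
      have "B (Q x) f = 0"
        unfolding c sum_left smult_left by (intro sum.neutral) (auto simp: row)
      then show ?thesis using Q[OF f_below] by simp
    qed
    then have "f = 0" using poly_all_0_iff_0 by blast
    then have "\<forall>l<N. v $ l = 0"
      using monic_family_independent[OF r] by (simp add: f_def)
    then show False using v(1,2) by (auto intro!: eq_vecI)
  qed
  then have unit: "A \<in> Units (ring_mat TYPE(complex) N ())"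
    by (rule det_non_zero_imp_unit[OF A])
  then obtain C where C: "mat_inverse A = Some C"
    using mat_inverse(1)[OF A, of "()"] by (cases "mat_inverse A") auto
  have inv: "A * C = 1\<^sub>m N" "C * A = 1\<^sub>m N" "C \<in> carrier_mat N N"
    using mat_inverse(2)[OF A C] by auto
  show "invertible_mat A"
    unfolding invertible_mat_def inverts_mat_def using A inv by auto
  obtain c where c: "Q x = (\<Sum>l<N. Polynomial.smult (c l) (r l))"
    using monic_family_spans[OF r Q_below] by blast
  have rx: "poly (r j) x = (\<Sum>l<N. c l * A $$ (l, j))" if "j < N" for j
    using Q[OF r_below[OF that], of x] that by (simp add: c sum_left smult_left A_def)
  have one: "(\<Sum>j<N. A $$ (l, j) * C $$ (j, k)) = (if l = k then 1 else 0)"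
    if "l < N" "k < N" for l k
    using arg_cong[OF inv(1), of "\<lambda>X. X $$ (l, k)"] that A inv(3)
    by (simp add: scalar_prod_def lessThan_atLeast0)
  have "(\<Sum>j<N. poly (r j) x * C $$ (j, k)) = c k" if "k < N" for k
  proof -
    have "(\<Sum>j<N. poly (r j) x * C $$ (j, k)) = (\<Sum>j<N. \<Sum>l<N. c l * (A $$ (l, j) * C $$ (j, k)))"
      by (intro sum.cong) (auto simp: rx sum_distrib_right mult.assoc)
    also have "\<dots> = (\<Sum>l<N. c l * (\<Sum>j<N. A $$ (l, j) * C $$ (j, k)))"
      by (subst sum.swap) (simp add: sum_distrib_left)
    also have "\<dots> = (\<Sum>l<N. if l = k then c k else 0)"
      using that by (intro sum.cong) (auto simp: one)
    finally show ?thesis using that by simp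
  qed
  then have "Q x = (\<Sum>k<N. Polynomial.smult (\<Sum>j<N. poly (r j) x * C $$ (j, k)) (r k))"
    unfolding c by (intro sum.cong) auto
  also have "\<dots> = (\<Sum>k<N. \<Sum>j<N. Polynomial.smult (poly (r j) x * C $$ (j, k)) (r k))"
    by (simp add: smult_sum)
  also have "\<dots> = (\<Sum>j<N. \<Sum>k<N. Polynomial.smult (poly (r j) x * C $$ (j, k)) (r k))"
    by (rule sum.swap)
  finally show "Q x = (\<Sum>j<N. \<Sum>k<N. Polynomial.smult (poly (r j) x * (the (mat_inverse A) $$ (j, k))) (r k))"
    by (simp add: C)
qed

section \<open>The sign kernel on the half-line\<close>

lemma FTC_halfline:
  fixes F f :: "real \<Rightarrow> complex"
  assumes S: "finite S" and cont: "continuous_on {0..} F"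
    and deriv: "\<And>s. s > 0 \<Longrightarrow> s \<notin> S \<Longrightarrow> (F has_vector_derivative f s) (at s)"
    and int: "set_integrable lborel {0..} f"
    and lim: "(F \<longlongrightarrow> 0) at_top"
  shows "u \<ge> 0 \<Longrightarrow> (LBINT s:{0..u}. f s) = F u - F 0"
    and "(LBINT s:{0..}. f s) = - F 0"
proof -
  have fin: "(LBINT s:{0..u}. f s) = F u - F 0" if "u \<ge> 0" for u
  proof -
    have "(f has_integral F u - F 0) {0..u}"
    proof (rule fundamental_theorem_of_calculus_interior_strong[OF S that])
      show "continuous_on {0..u} F" by (rule continuous_on_subset[OF cont]) auto
    qed (use deriv in auto)
    moreover have "set_integrable lborel {0..u} f"
      by (rule set_integrable_subset[OF int]) auto
    ultimately show ?thesis
      using set_borel_integral_eq_integral(2) by (metis integral_unique)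
  qed
  then show "u \<ge> 0 \<Longrightarrow> (LBINT s:{0..u}. f s) = F u - F 0" .
  have "((\<lambda>u. LBINT s:{0..u}. f s) \<longlongrightarrow> (LBINT s:{0..}. f s)) at_top"
    by (rule tendsto_set_lebesgue_integral_at_top[OF _ int]) simp
  moreover have "((\<lambda>u. LBINT s:{0..u}. f s) \<longlongrightarrow> 0 - F 0) at_top"
  proof (rule Lim_transform_eventually)
    show "((\<lambda>u. F u - F 0) \<longlongrightarrow> 0 - F 0) at_top" by (intro tendsto_intros lim)
    show "\<forall>\<^sub>F u in at_top. F u - F 0 = (LBINT s:{0..u}. f s)"
      using eventually_ge_at_top[of 0] by eventually_elim (simp add: fin)
  qed
  ultimately show "(LBINT s:{0..}. f s) = - F 0"
    using tendsto_unique by (metis diff_0 trivial_limit_at_top_linorder)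
qed

text \<open>For a primitive F vanishing at both ends, half the integral up to u minus half the
integral from u on is F u / 2 - (- F u) / 2.\<close>

lemma integral_sgn_halfline:
  fixes F f :: "real \<Rightarrow> complex"
  assumes "finite S" and "continuous_on {0..} F"
    and "\<And>s. s > 0 \<Longrightarrow> s \<notin> S \<Longrightarrow> (F has_vector_derivative f s) (at s)"
    and int: "set_integrable lborel {0..} f"
    and "(F \<longlongrightarrow> 0) at_top" and "F 0 = 0" and u: "u \<ge> 0"
  shows "(LBINT s:{0..}. of_real (sgn (u - s) / 2) * f s) = F u"
proof -
  note FTC = FTC_halfline[OF assms(1-5)]
  have int_u: "set_integrable lborel {0..u} f"
    by (rule set_integrable_subset[OF int]) auto
  have "(LBINT s:{0..}. of_real (sgn (u - s) / 2) * f s)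
      = (LBINT s. indicator {0..u} s *\<^sub>R f s - (1/2) * (indicator {0..} s *\<^sub>R f s))"
    unfolding set_lebesgue_integral_def
  proof (rule integral_discrete_difference[of "{u}"])
    fix s assume "s \<notin> {u}"
    then show "indicator {0..} s *\<^sub>R (of_real (sgn (u - s) / 2) * f s)
        = indicator {0..u} s *\<^sub>R f s - (1/2) * (indicator {0..} s *\<^sub>R f s)"
      by (auto simp: indicator_def sgn_if scaleR_conv_of_real field_simps)
  qed auto
  also have "\<dots> = (LBINT s. indicator {0..u} s *\<^sub>R f s) - (LBINT s. (1/2) * (indicator {0..} s *\<^sub>R f s))"
    using int int_u unfolding set_integrable_def
    by (intro Bochner_Integration.integral_diff integrable_mult_right)
  also have "\<dots> = (LBINT s:{0..u}. f s) - (1/2) * (LBINT s:{0..}. f s)"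
    by (simp only: integral_mult_right_zero set_lebesgue_integral_def)
  finally show ?thesis using FTC u \<open>F 0 = 0\<close> by simp
qed

lemma norm_half_sgn_mult_le: "norm (of_real (sgn x / 2) * z) \<le> norm z" for x :: real and z :: complex
  by (simp add: norm_mult sgn_if)

lemma integrable_sgn_product:
  fixes \<phi> \<psi> :: "real \<Rightarrow> complex"
  assumes \<phi>: "integrable lborel \<phi>" and \<psi>: "integrable lborel \<psi>"
  shows "integrable (lborel \<Otimes>\<^sub>M lborel) (\<lambda>(s, u). of_real (sgn (s - u) / 2) * (\<phi> s * \<psi> u))"
proof -
  have m: "\<phi> \<in> borel_measurable lborel" "\<psi> \<in> borel_measurable lborel"
    using assms by auto
  have [measurable]: "\<phi> \<in> borel_measurable borel" "\<psi> \<in> borel_measurable borel"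
    using m by simp_all
  have "integrable (lborel \<Otimes>\<^sub>M lborel) (\<lambda>(s, u). \<phi> s * \<psi> u)"
  proof (rule lborel_pair.Fubini_integrable)
    show "integrable lborel (\<lambda>x. LBINT y. norm (case (x, y) of (s, u) \<Rightarrow> \<phi> s * \<psi> u))"
      using \<phi> by (simp add: norm_mult)
    show "AE x in lborel. integrable lborel (\<lambda>y. case (x, y) of (s, u) \<Rightarrow> \<phi> s * \<psi> u)"
      using \<psi> by simp
  qed measurable
  then show ?thesis
  proof (rule Bochner_Integration.integrable_bound)
    show "(\<lambda>(s, u). of_real (sgn (s - u) / 2) * (\<phi> s * \<psi> u)) \<in> borel_measurable (lborel \<Otimes>\<^sub>M lborel)"
      by measurable
    show "AE x in lborel \<Otimes>\<^sub>M lborel. norm (case x of (s, u) \<Rightarrow> of_real (sgn (s - u) / 2) * (\<phi> s * \<psi> u))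
        \<le> norm (case x of (s, u) \<Rightarrow> \<phi> s * \<psi> u)"
      by (rule AE_I2) (auto simp only: prod.case norm_half_sgn_mult_le split: prod.split)
  qed
qed

text \<open>The skew form of densities on the line. As an integral over the plane it is visibly
bilinear and antisymmetric.\<close>

definition sgn_pairing :: "(real \<Rightarrow> complex) \<Rightarrow> (real \<Rightarrow> complex) \<Rightarrow> complex" where
  "sgn_pairing \<phi> \<psi> = (\<integral>(s, u). of_real (sgn (s - u) / 2) * (\<phi> s * \<psi> u) \<partial>(lborel \<Otimes>\<^sub>M lborel))"

lemma sgn_pairing_iterated:
  assumes "integrable lborel \<phi>" "integrable lborel \<psi>"
  shows "sgn_pairing \<phi> \<psi> = (LBINT u. LBINT s. of_real (sgn (s - u) / 2) * (\<phi> s * \<psi> u))"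
  unfolding sgn_pairing_def
  using lborel_pair.integral_snd[OF integrable_sgn_product[OF assms]] by simp

lemma sgn_pairing_skew:
  assumes "integrable lborel \<phi>" "integrable lborel \<psi>"
  shows "sgn_pairing \<phi> \<psi> = - sgn_pairing \<psi> \<phi>"
proof -
  have "sgn_pairing \<phi> \<psi> = (\<integral>(s, u). of_real (sgn (u - s) / 2) * (\<phi> u * \<psi> s) \<partial>(lborel \<Otimes>\<^sub>M lborel))"
    unfolding sgn_pairing_def
    using lborel_pair.integral_product_swap[OF borel_measurable_integrable[OF integrable_sgn_product[OF assms]]]
    by simp
  also have "\<dots> = (\<integral>p. - (case p of (s, u) \<Rightarrow> of_real (sgn (s - u) / 2) * (\<psi> s * \<phi> u)) \<partial>(lborel \<Otimes>\<^sub>M lborel))"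
    by (rule Bochner_Integration.integral_cong)
      (auto simp: sgn_if mult.commute)
  finally show ?thesis by (simp add: sgn_pairing_def)
qed

lemma sgn_pairing_add:
  assumes "integrable lborel \<phi>" "integrable lborel \<phi>'" "integrable lborel \<psi>"
  shows "sgn_pairing (\<lambda>s. \<phi> s + \<phi>' s) \<psi> = sgn_pairing \<phi> \<psi> + sgn_pairing \<phi>' \<psi>"
proof -
  have "(\<lambda>(s, u). of_real (sgn (s - u) / 2) * ((\<phi> s + \<phi>' s) * \<psi> u))
      = (\<lambda>p. (case p of (s, u) \<Rightarrow> of_real (sgn (s - u) / 2) * (\<phi> s * \<psi> u))
           + (case p of (s, u) \<Rightarrow> of_real (sgn (s - u) / 2) * (\<phi>' s * \<psi> u)))"
    by (auto simp: fun_eq_iff algebra_simps)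
  then show ?thesis
    unfolding sgn_pairing_def
    using Bochner_Integration.integral_add[OF integrable_sgn_product[OF assms(1,3)]
        integrable_sgn_product[OF assms(2,3)]] by simp
qed

lemma sgn_pairing_cmult: "sgn_pairing (\<lambda>s. c * \<phi> s) \<psi> = c * sgn_pairing \<phi> \<psi>"
proof -
  have "(\<lambda>(s, u). of_real (sgn (s - u) / 2) * (c * \<phi> s * \<psi> u))
      = (\<lambda>p. c * (case p of (s, u) \<Rightarrow> of_real (sgn (s - u) / 2) * (\<phi> s * \<psi> u)))"
    by (auto simp: fun_eq_iff)
  then show ?thesis
    unfolding sgn_pairing_def by (simp only: integral_mult_right_zero)
qed

section \<open>Integration along the contour\<close>

locale contour =
  fixes \<gamma> :: "real \<Rightarrow> complex"
  assumes halfline: "halfline_contour \<gamma>"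
begin

lemma \<gamma>_0: "\<gamma> 0 = 0" and \<gamma>_Re: "s > 0 \<Longrightarrow> Re (\<gamma> s) > 0" and \<gamma>_inj: "inj_on \<gamma> {0..}"
  and \<gamma>_cont: "continuous_on {0..} \<gamma>"
  using halfline by (auto simp: halfline_contour_def piecewise_C1_differentiable_on_def)

lemma \<gamma>_end: "\<forall>\<^sub>F s in at_top. \<gamma> s = of_real s"
  using halfline unfolding halfline_contour_def eventually_at_top_linorder by blast

lemma \<gamma>_nonpos: "s > 0 \<Longrightarrow> \<gamma> s \<notin> \<real>\<^sub>\<le>\<^sub>0"
  using \<gamma>_Re by (auto simp: complex_nonpos_Reals_iff not_le)

text \<open>The point 0 is counted as a break, because the derivative there is two-sided and involves
values of the curve outside its domain.\<close>

lemma \<gamma>_breaks: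
  obtains S where "finite S" "0 \<in> S"
    "\<And>s. s \<ge> 0 \<Longrightarrow> s \<notin> S \<Longrightarrow> (\<gamma> has_vector_derivative vector_derivative \<gamma> (at s)) (at s)"
    "continuous_on ({0..} - S) (\<lambda>s. vector_derivative \<gamma> (at s))"
proof -
  obtain S where S: "finite S" "\<gamma> C1_differentiable_on ({0..} - S)"
    using halfline by (auto simp: halfline_contour_def piecewise_C1_differentiable_on_def)
  then show ?thesis
    unfolding C1_differentiable_on_eq
    by (intro that[of "insert 0 S"])
      (auto intro: continuous_on_subset simp: vector_derivative_works[symmetric])
qed

text \<open>The Lipschitz constant bounds all difference quotients.\<close>

lemma \<gamma>_deriv_bound:
  obtains C where "C \<ge> 0"
    "\<And>s d. s > 0 \<Longrightarrow> (\<gamma> has_vector_derivative d) (at s) \<Longrightarrow> norm d \<le> C"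
proof -
  obtain C where C: "C-lipschitz_on {0..} \<gamma>"
    using halfline by (auto simp: halfline_contour_def)
  show ?thesis
  proof (rule that)
    show "C \<ge> 0" using C by (rule lipschitz_on_nonneg)
    fix s d assume s: "s > 0" and d: "(\<gamma> has_vector_derivative d) (at s)"
    define e where "e = (\<lambda>k. norm (\<gamma> (s + k) - \<gamma> s - k *\<^sub>R d) / norm k)"
    have "(e \<longlongrightarrow> 0) (at 0)"
      using d unfolding e_def has_vector_derivative_def has_derivative_at by simp
    then have "((\<lambda>k. C + e k) \<longlongrightarrow> C + 0) (at 0)" by (intro tendsto_intros)
    moreover have "\<forall>\<^sub>F k in at 0. norm d \<le> C + e k"
      unfolding eventually_at
    proof (intro exI[of _ s] conjI ballI impI s)
      fix k :: real assume k: "k \<noteq> 0 \<and> dist k 0 < s"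
      have "norm (k *\<^sub>R d) \<le> norm (\<gamma> (s + k) - \<gamma> s) + norm (\<gamma> (s + k) - \<gamma> s - k *\<^sub>R d)"
        by (metis norm_triangle_sub norm_minus_commute add.commute)
      also have "norm (\<gamma> (s + k) - \<gamma> s) \<le> C * norm k"
        using lipschitz_onD[OF C, of "s + k" s] s k by (auto simp: dist_norm)
      finally have "norm k * norm d \<le> C * norm k + e k * norm k"
        using k by (simp add: e_def)
      then have "norm k * norm d \<le> norm k * (C + e k)" by (simp add: algebra_simps)
      then show "norm d \<le> C + e k" using k by simp
    qed
    ultimately show "norm d \<le> C"
      using tendsto_lowerbound by (metis add.right_neutral at_neq_bot)
  qed
qed

text \<open>Decay faster than exp (- s). For real s large the contour is the real axis, so this
is decay in the ordinary sense; it gives integrability along the contour.\<close>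

definition tame :: "(complex \<Rightarrow> complex) \<Rightarrow> bool" where
  "tame f \<longleftrightarrow> continuous_on {0..} (\<lambda>s. f (\<gamma> s)) \<and> ((\<lambda>s. of_real (exp s) * f (\<gamma> s)) \<longlongrightarrow> 0) at_top"

lemma tame_bound:
  assumes "tame f"
  obtains b where "b \<ge> 0" "\<And>s. s \<ge> 0 \<Longrightarrow> norm (f (\<gamma> s)) \<le> b * exp (- s)"
proof -
  let ?g = "\<lambda>s. of_real (exp s) * f (\<gamma> s)"
  have "\<forall>\<^sub>F s in at_top. norm (?g s) < 1"
    using assms unfolding tame_def by (intro order_tendstoD(2)[OF tendsto_norm_zero]) auto
  then obtain R where R: "\<And>s. s \<ge> R \<Longrightarrow> norm (?g s) < 1"
    unfolding eventually_at_top_linorder by auto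
  have "continuous_on {0..R} ?g"
    using assms unfolding tame_def
    by (auto intro!: continuous_intros intro: continuous_on_subset)
  then have "bounded (?g ` {0..R})"
    by (intro compact_imp_bounded compact_continuous_image) auto
  then obtain b where b: "\<And>s. s \<in> {0..R} \<Longrightarrow> norm (?g s) \<le> b"
    unfolding bounded_iff by blast
  show ?thesis
  proof (rule that)
    fix s :: real assume "s \<ge> 0"
    then have "norm (?g s) \<le> max b 1"
      using R[of s] b[of s] by (cases "s \<le> R") (auto simp: less_imp_le max.coboundedI1 max.coboundedI2)
    then show "norm (f (\<gamma> s)) \<le> max b 1 * exp (- s)"
      by (simp add: norm_mult exp_minus field_simps)
  qed auto
qed

lemma tame_integrable:
  assumes "tame f"
  shows "set_integrable lborel {0..} (\<lambda>s. f (\<gamma> s) * vector_derivative \<gamma> (at s))"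
proof -
  let ?f = "\<lambda>s. f (\<gamma> s) * vector_derivative \<gamma> (at s)"
  obtain S where S: "finite S" "0 \<in> S"
    "\<And>s. s \<ge> 0 \<Longrightarrow> s \<notin> S \<Longrightarrow> (\<gamma> has_vector_derivative vector_derivative \<gamma> (at s)) (at s)"
    "continuous_on ({0..} - S) (\<lambda>s. vector_derivative \<gamma> (at s))"
    using \<gamma>_breaks by blast
  obtain C where C: "C \<ge> 0"
    "\<And>s d. s > 0 \<Longrightarrow> (\<gamma> has_vector_derivative d) (at s) \<Longrightarrow> norm d \<le> C"
    using \<gamma>_deriv_bound by blast
  obtain b where b: "b \<ge> 0" "\<And>s. s \<ge> 0 \<Longrightarrow> norm (f (\<gamma> s)) \<le> b * exp (- s)"
    using tame_bound[OF assms] by blast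
  have exp_int: "set_integrable lborel {0..} (\<lambda>s::real. exp (- s))"
  proof -
    have "(\<lambda>s::real. exp (- s)) absolutely_integrable_on {0..}"
      using integrable_on_exp_minus_to_infinity[of 1 0]
      by (intro nonnegative_absolutely_integrable_1) auto
    then show ?thesis
      by (simp add: set_integrable_def integrable_completion)
  qed
  have "integrable lborel (\<lambda>s. indicator ({0..} - S) s *\<^sub>R ?f s)"
  proof (rule Bochner_Integration.integrable_bound)
    show "integrable lborel (\<lambda>s. (b * C) * (indicator {0..} s *\<^sub>R exp (- s) :: real))"
      using exp_int unfolding set_integrable_def by (intro integrable_mult_right)
    have "continuous_on ({0..} - S) ?f"
      using assms S(4) unfolding tame_def
      by (auto intro!: continuous_intros intro: continuous_on_subset)
    moreover have "{0..} - S \<in> sets borel"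
      using S(1) by (intro sets.Diff) (auto intro: borel_closed finite_imp_closed)
    ultimately show "(\<lambda>s. indicator ({0..} - S) s *\<^sub>R ?f s) \<in> borel_measurable lborel"
      using borel_measurable_continuous_on_indicator by simp
    show "AE s in lborel. norm (indicator ({0..} - S) s *\<^sub>R ?f s)
        \<le> norm ((b * C) * (indicator {0..} s *\<^sub>R exp (- s) :: real))"
    proof (rule AE_I2)
      fix s :: real
      show "norm (indicator ({0..} - S) s *\<^sub>R ?f s)
        \<le> norm ((b * C) * (indicator {0..} s *\<^sub>R exp (- s) :: real))"
      proof (cases "s \<in> {0..} - S")
        case True
        then have "s > 0" using S(2) by (cases "s = 0") auto
        then have "norm (f (\<gamma> s)) * norm (vector_derivative \<gamma> (at s)) \<le> (b * exp (- s)) * C"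
          using True b C S(3)[of s] by (intro mult_mono) auto
        then show ?thesis using True b(1) C(1) by (simp add: norm_mult mult.commute mult.left_commute)
      next
        case False
        then have "indicator ({0..} - S) s = (0::real)" by (simp add: indicator_def)
        then show ?thesis by simp
      qed
    qed
  qed
  moreover have "integrable lborel (\<lambda>s. indicator ({0..} - S) s *\<^sub>R ?f s)
      \<longleftrightarrow> integrable lborel (\<lambda>s. indicator {0..} s *\<^sub>R ?f s)"
    by (rule integrable_discrete_difference[of S])
      (use S(1) in \<open>auto simp: countable_finite indicator_def\<close>)
  ultimately show ?thesis by (simp add: set_integrable_def)
qed

lemma tame_cmult: "tame f \<Longrightarrow> tame (\<lambda>z. c * f z)"
  unfolding tame_def using tendsto_mult_right_zero[of _ at_top c]
  by (auto simp: mult.left_commute intro: continuous_on_mult_left)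

lemma tame_tendsto_0:
  assumes "tame f"
  shows "((\<lambda>s. f (\<gamma> s)) \<longlongrightarrow> 0) at_top"
proof -
  have "((\<lambda>s. of_real (exp (- s)) * (of_real (exp s) * f (\<gamma> s))) \<longlongrightarrow> of_real 0 * 0) at_top"
    using assms unfolding tame_def
    by (intro tendsto_mult tendsto_of_real filterlim_compose[OF exp_at_bot filterlim_uminus_at_bot_at_top])
      auto
  then show ?thesis
    by (simp add: mult.assoc[symmetric] exp_minus flip: of_real_mult exp_add)
qed

lemma contour_int_add:
  "tame f \<Longrightarrow> tame g \<Longrightarrow> contour_int \<gamma> (\<lambda>z. f z + g z) = contour_int \<gamma> f + contour_int \<gamma> g"
  unfolding contour_int_def
  by (subst set_integral_add(2)[symmetric]) (auto simp: tame_integrable distrib_right)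

lemma contour_int_cmult: "contour_int \<gamma> (\<lambda>z. c * f z) = c * contour_int \<gamma> f"
  unfolding contour_int_def by (simp add: mult.assoc)

lemma contour_int_cong:
  assumes "\<And>s. s \<ge> 0 \<Longrightarrow> f (\<gamma> s) = g (\<gamma> s)"
  shows "contour_int \<gamma> f = contour_int \<gamma> g"
  unfolding contour_int_def by (rule set_lebesgue_integral_cong) (auto simp: assms)

lemma eps_sgn_\<gamma>:
  "s \<ge> 0 \<Longrightarrow> u \<ge> 0 \<Longrightarrow> eps_sgn \<gamma> (\<gamma> s) (\<gamma> u) = of_real (sgn (s - u) / 2)"
  by (simp add: eps_sgn_def the_inv_into_f_f[OF \<gamma>_inj])

lemma eps_sgn_skew: "eps_sgn \<gamma> x y = - eps_sgn \<gamma> y x"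
  by (simp add: eps_sgn_def sgn_if)

lemma eps_op_\<gamma>:
  assumes "u \<ge> 0"
  shows "eps_op \<gamma> f (\<gamma> u)
    = (LBINT s:{0..}. of_real (sgn (u - s) / 2) * (f (\<gamma> s) * vector_derivative \<gamma> (at s)))"
  unfolding eps_op_def contour_int_def
  by (rule set_lebesgue_integral_cong) (auto simp: eps_sgn_\<gamma>[OF assms] mult.assoc)

lemma tame_sgn_integrable:
  assumes "tame f"
  shows "set_integrable lborel {0..}
    (\<lambda>s. of_real (sgn (u - s) / 2) * (f (\<gamma> s) * vector_derivative \<gamma> (at s)))"
proof -
  have int: "integrable lborel (\<lambda>s. indicator {0..} s *\<^sub>R (f (\<gamma> s) * vector_derivative \<gamma> (at s)))"
    using tame_integrable[OF assms] by (simp add: set_integrable_def)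
  then have [measurable]:
    "(\<lambda>s. indicator {0..} s *\<^sub>R (f (\<gamma> s) * vector_derivative \<gamma> (at s))) \<in> borel_measurable borel"
    using borel_measurable_integrable by fastforce
  have "integrable lborel (\<lambda>s. of_real (sgn (u - s) / 2) *
      (indicator {0..} s *\<^sub>R (f (\<gamma> s) * vector_derivative \<gamma> (at s))))"
  proof (rule Bochner_Integration.integrable_bound[OF int _ AE_I2])
    fix s
    show "norm (of_real (sgn (u - s) / 2) * (indicator {0..} s *\<^sub>R (f (\<gamma> s) * vector_derivative \<gamma> (at s))))
        \<le> norm (indicator {0..} s *\<^sub>R (f (\<gamma> s) * vector_derivative \<gamma> (at s)))"
      by (rule norm_half_sgn_mult_le)
  qed measurable
  then show ?thesis
    unfolding set_integrable_def by (simp add: mult.left_commute scaleR_conv_of_real)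
qed

lemma eps_op_add:
  assumes "tame f" "tame g" "u \<ge> 0"
  shows "eps_op \<gamma> (\<lambda>z. f z + g z) (\<gamma> u) = eps_op \<gamma> f (\<gamma> u) + eps_op \<gamma> g (\<gamma> u)"
  unfolding eps_op_\<gamma>[OF assms(3)] distrib_right distrib_left
  by (rule set_integral_add(2)[OF tame_sgn_integrable[OF assms(1)] tame_sgn_integrable[OF assms(2)]])

lemma eps_op_cmult: "eps_op \<gamma> (\<lambda>z. c * f z) y = c * eps_op \<gamma> f y"
  unfolding eps_op_def
  using contour_int_cmult[of c "\<lambda>x. eps_sgn \<gamma> y x * f x"] by (simp add: mult.left_commute)

lemma eps_op_primitive:
  assumes f: "tame f" and cont: "continuous_on {0..} F" and "(F \<longlongrightarrow> 0) at_top" and "F 0 = 0"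
    and deriv: "\<And>s. s > 0 \<Longrightarrow> (\<gamma> has_vector_derivative vector_derivative \<gamma> (at s)) (at s) \<Longrightarrow>
         (F has_vector_derivative f (\<gamma> s) * vector_derivative \<gamma> (at s)) (at s)"
    and u: "u \<ge> 0"
  shows "eps_op \<gamma> f (\<gamma> u) = F u"
proof -
  obtain S where S: "finite S"
    "\<And>s. s \<ge> 0 \<Longrightarrow> s \<notin> S \<Longrightarrow> (\<gamma> has_vector_derivative vector_derivative \<gamma> (at s)) (at s)"
    using \<gamma>_breaks by blast
  show ?thesis
    unfolding eps_op_\<gamma>[OF u]
    using assms S by (intro integral_sgn_halfline[OF S(1) cont _ tame_integrable]) auto
qed

lemma contour_int_primitive:
  assumes f: "tame f" and cont: "continuous_on {0..} F" and "(F \<longlongrightarrow> 0) at_top"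
    and deriv: "\<And>s. s > 0 \<Longrightarrow> (\<gamma> has_vector_derivative vector_derivative \<gamma> (at s)) (at s) \<Longrightarrow>
         (F has_vector_derivative f (\<gamma> s) * vector_derivative \<gamma> (at s)) (at s)"
  shows "contour_int \<gamma> f = - F 0"
proof -
  obtain S where S: "finite S"
    "\<And>s. s \<ge> 0 \<Longrightarrow> s \<notin> S \<Longrightarrow> (\<gamma> has_vector_derivative vector_derivative \<gamma> (at s)) (at s)"
    using \<gamma>_breaks by blast
  show ?thesis
    unfolding contour_int_def
    using assms S by (intro FTC_halfline(2)[OF S(1) cont _ tame_integrable]) auto
qed

end

section \<open>The skew form of a rapidly decaying weight\<close>

text \<open>All that the skew form needs from its weight: enough decay for the double integral to converge
absolutely, so that the order of integration does not matter.\<close>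

locale tame_weight = contour \<gamma> for \<gamma> +
  fixes w :: "complex \<Rightarrow> complex"
  assumes tame_poly: "tame (\<lambda>z. poly p z * w z)"
begin

text \<open>The density of p w along the contour, extended by 0 to the whole line.\<close>

definition pullback :: "complex poly \<Rightarrow> real \<Rightarrow> complex" where
  "pullback p s = indicator {0..} s * (poly p (\<gamma> s) * w (\<gamma> s) * vector_derivative \<gamma> (at s))"

lemma pullback_integrable: "integrable lborel (pullback p)"
  using tame_integrable[OF tame_poly, of p]
  by (simp add: set_integrable_def pullback_def[abs_def] scaleR_conv_of_real of_real_indicator)

lemma skew1_eq_sgn_pairing: "skew1 \<gamma> w f g = sgn_pairing (pullback f) (pullback g)"
proof -
  let ?d = "\<lambda>s. vector_derivative \<gamma> (at s)"
  have "skew1 \<gamma> w f g = (LBINT u:{0..}. (LBINT s:{0..}. of_real (sgn (s - u) / 2) *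
      (poly f (\<gamma> s) * w (\<gamma> s) * ?d s) * (poly g (\<gamma> u) * w (\<gamma> u))) * ?d u)"
    unfolding skew1_def contour_int_def
  proof (intro set_lebesgue_integral_cong allI impI)
    fix u :: real assume "u \<in> {0..}"
    then have "(LBINT s:{0..}. eps_sgn \<gamma> (\<gamma> s) (\<gamma> u) * poly f (\<gamma> s) * poly g (\<gamma> u) * w (\<gamma> s)
          * w (\<gamma> u) * ?d s)
        = (LBINT s:{0..}. of_real (sgn (s - u) / 2) * (poly f (\<gamma> s) * w (\<gamma> s) * ?d s)
          * (poly g (\<gamma> u) * w (\<gamma> u)))"
      by (intro set_lebesgue_integral_cong) (auto simp: eps_sgn_\<gamma>)
    then show "(LBINT s:{0..}. eps_sgn \<gamma> (\<gamma> s) (\<gamma> u) * poly f (\<gamma> s) * poly g (\<gamma> u) * w (\<gamma> s)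
          * w (\<gamma> u) * ?d s) * ?d u
        = (LBINT s:{0..}. of_real (sgn (s - u) / 2) * (poly f (\<gamma> s) * w (\<gamma> s) * ?d s)
          * (poly g (\<gamma> u) * w (\<gamma> u))) * ?d u"
      by simp
  qed simp
  also have "\<dots> = (LBINT u. LBINT s. of_real (sgn (s - u) / 2) * (pullback f s * pullback g u))"
    unfolding set_lebesgue_integral_def pullback_def
    by (intro Bochner_Integration.integral_cong refl)
      (simp add: scaleR_conv_of_real of_real_indicator mult_ac
        flip: Bochner_Integration.integral_mult_right_zero Bochner_Integration.integral_mult_left_zero)
  finally show ?thesis
    by (simp only: sgn_pairing_iterated[OF pullback_integrable pullback_integrable])
qed

lemma skew1_skew: "skew1 \<gamma> w f g = - skew1 \<gamma> w g f"
  unfolding skew1_eq_sgn_pairing by (rule sgn_pairing_skew[OF pullback_integrable pullback_integrable])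

lemma skew1_add: "skew1 \<gamma> w (f + g) k = skew1 \<gamma> w f k + skew1 \<gamma> w g k"
proof -
  have "pullback (f + g) = (\<lambda>s. pullback f s + pullback g s)"
    by (auto simp: pullback_def algebra_simps)
  then show ?thesis
    unfolding skew1_eq_sgn_pairing by (simp only: sgn_pairing_add[OF pullback_integrable pullback_integrable pullback_integrable])
qed

lemma skew1_smult: "skew1 \<gamma> w (Polynomial.smult c f) k = c * skew1 \<gamma> w f k"
proof -
  have "pullback (Polynomial.smult c f) = (\<lambda>s. c * pullback f s)"
    by (auto simp: pullback_def algebra_simps)
  then show ?thesis
    unfolding skew1_eq_sgn_pairing by (simp only: sgn_pairing_cmult)
qed

text \<open>The inner integral in the definition is taken over the first argument, hence the sign.\<close>

lemma skew1_eq_eps_op: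
  "skew1 \<gamma> w f g = - contour_int \<gamma> (\<lambda>y. poly g y * w y * eps_op \<gamma> (\<lambda>z. poly f z * w z) y)"
proof -
  have "contour_int \<gamma> (\<lambda>x. eps_sgn \<gamma> x y * poly f x * poly g y * w x * w y)
      = - 1 * (poly g y * w y * eps_op \<gamma> (\<lambda>z. poly f z * w z) y)" for y
  proof -
    have "contour_int \<gamma> (\<lambda>x. eps_sgn \<gamma> x y * poly f x * poly g y * w x * w y)
        = contour_int \<gamma> (\<lambda>x. (- poly g y * w y) * (eps_sgn \<gamma> y x * (poly f x * w x)))"
      by (rule contour_int_cong) (simp add: eps_sgn_skew[of _ y] mult_ac)
    then show ?thesis by (simp only: contour_int_cmult eps_op_def) simp
  qed
  then show ?thesis
    unfolding skew1_def by (simp only: contour_int_cmult) simp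
qed

lemma eps_op_sum:
  assumes "u \<ge> 0"
  shows "eps_op \<gamma> (\<lambda>z. poly (\<Sum>j\<in>A. Polynomial.smult (c j) (f j)) z * w z) (\<gamma> u)
    = (\<Sum>j\<in>A. c j * eps_op \<gamma> (\<lambda>z. poly (f j) z * w z) (\<gamma> u))"
proof (induction A rule: infinite_finite_induct)
  case (insert j A)
  have "eps_op \<gamma> (\<lambda>z. c j * (poly (f j) z * w z)
        + poly (\<Sum>j\<in>A. Polynomial.smult (c j) (f j)) z * w z) (\<gamma> u)
      = c j * eps_op \<gamma> (\<lambda>z. poly (f j) z * w z) (\<gamma> u)
        + (\<Sum>j\<in>A. c j * eps_op \<gamma> (\<lambda>z. poly (f j) z * w z) (\<gamma> u))"
    by (subst eps_op_add[OF tame_cmult[OF tame_poly] tame_poly assms]) (simp add: eps_op_cmult insert)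
  then show ?case using insert by (simp add: distrib_right mult.assoc)
qed (simp_all add: eps_op_cmult[of 0 "\<lambda>_. 0", simplified])

end

section \<open>Exponential decay, square roots, and moments along the contour\<close>

text \<open>By induction on the polynomial: half of the exponential rate absorbs one factor s, the other half is left for the
induction hypothesis.\<close>

lemma poly_exp_decay:
  assumes "c > 0"
  shows "((\<lambda>s. exp (- c * s) * norm (poly p (complex_of_real s))) \<longlongrightarrow> 0) at_top"
  using assms
proof (induction p arbitrary: c)
  case 0
  then show ?case by simp
next
  case (pCons a p)
  have e: "((\<lambda>s::real. exp (- c * s)) \<longlongrightarrow> 0) at_top" if "c > 0" for c
    using that by real_asymp
  have "((\<lambda>s::real. s * exp (- (c / 2) * s)) \<longlongrightarrow> 0) at_top"
    using \<open>c > 0\<close> by real_asymp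
  moreover have "((\<lambda>s. exp (- (c / 2) * s) * norm (poly p (complex_of_real s))) \<longlongrightarrow> 0) at_top"
    using pCons.prems by (intro pCons.IH) simp
  ultimately have "((\<lambda>s. exp (- c * s) * norm a + (s * exp (- (c / 2) * s))
      * (exp (- (c / 2) * s) * norm (poly p (complex_of_real s)))) \<longlongrightarrow> 0 * norm a + 0 * 0) at_top"
    using e[OF \<open>c > 0\<close>] by (intro tendsto_intros)
  then have lim: "((\<lambda>s. exp (- c * s) * norm a + (s * exp (- (c / 2) * s))
      * (exp (- (c / 2) * s) * norm (poly p (complex_of_real s)))) \<longlongrightarrow> 0) at_top"
    by simp
  show ?case
  proof (rule Lim_null_comparison[OF _ lim])
    show "\<forall>\<^sub>F s in at_top. norm (exp (- c * s) * norm (poly (pCons a p) (complex_of_real s)))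
       \<le> exp (- c * s) * norm a + (s * exp (- (c / 2) * s))
          * (exp (- (c / 2) * s) * norm (poly p (complex_of_real s)))"
      using eventually_ge_at_top[of 0]
    proof eventually_elim
      fix s :: real assume s: "0 \<le> s"
      have half: "exp (- (c / 2) * s) * exp (- (c / 2) * s) = exp (- c * s)"
        by (simp flip: exp_add)
      have "norm (poly (pCons a p) (complex_of_real s)) \<le> norm a + s * norm (poly p (complex_of_real s))"
        using norm_triangle_ineq[of a "of_real s * poly p (of_real s)"] s by (simp add: norm_mult)
      then have "exp (- c * s) * norm (poly (pCons a p) (complex_of_real s))
          \<le> exp (- c * s) * (norm a + s * norm (poly p (complex_of_real s)))"
        by (intro mult_left_mono) auto
      also have "\<dots> = exp (- c * s) * norm a + (s * exp (- (c / 2) * s))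
          * (exp (- (c / 2) * s) * norm (poly p (complex_of_real s)))"
        unfolding half[symmetric] by (simp add: algebra_simps)
      finally show "norm (exp (- c * s) * norm (poly (pCons a p) (complex_of_real s)))
       \<le> exp (- c * s) * norm a + (s * exp (- (c / 2) * s))
          * (exp (- (c / 2) * s) * norm (poly p (complex_of_real s)))"
        by (simp add: abs_mult)
    qed
  qed
qed

text \<open>A continuous branch of the square root is differentiable: near s the quotient r u / r s is
close to 1, so it is the principal square root of g u / g s.\<close>

lemma has_vector_derivative_sqrt_branch:
  fixes r g :: "real \<Rightarrow> complex"
  assumes cont: "isCont r s" and sq: "\<forall>\<^sub>F u in nhds s. r u ^ 2 = g u" and nz: "r s \<noteq> 0"
    and g: "(g has_vector_derivative g') (at s)"
  shows "(r has_vector_derivative g' / (2 * r s)) (at s)"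
proof -
  define q where "q = (\<lambda>z. r s * csqrt (z / g s))"
  have gs: "g s = r s ^ 2" using eventually_nhds_x_imp_x[OF sq] by simp
  have "(q has_field_derivative 1 / (2 * r s)) (at (g s))"
    unfolding q_def using nz
    by (auto intro!: derivative_eq_intros simp: gs) (simp add: power2_eq_square power4_eq_xxxx)
  from field_vector_diff_chain_at[OF g this]
  have qg: "(q \<circ> g has_vector_derivative g' / (2 * r s)) (at s)" by simp
  have "isCont (\<lambda>u. Re (r u / r s)) s"
    using cont nz unfolding isCont_def by (intro tendsto_intros) auto
  then have "((\<lambda>u. Re (r u / r s)) \<longlongrightarrow> 1) (nhds s)"
    using nz by (simp add: continuous_at tendsto_nhds_iff)
  then have "\<forall>\<^sub>F u in nhds s. 0 < Re (r u / r s)"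
    by (rule order_tendstoD) simp
  then have ev: "\<forall>\<^sub>F u in nhds s. (q \<circ> g) u = r u"
    using sq
  proof eventually_elim
    case (elim u)
    have "csqrt (g u / g s) = r u / r s"
      using csqrt_square[of "r u / r s"] elim by (simp add: gs power_divide)
    then show ?case using nz by (simp add: q_def)
  qed
  have "\<forall>\<^sub>F u in at s. (q \<circ> g) u = r u"
    using ev by (auto simp: eventually_at_filter elim: eventually_mono)
  from has_derivative_transform_eventually[OF qg[unfolded has_vector_derivative_def] this
      eventually_nhds_x_imp_x[OF ev] UNIV_I]
  show ?thesis unfolding has_vector_derivative_def .
qed

text \<open>In this form, with the factor k / (2 z), the exponent k = 0 needs no separate treatment.\<close>

lemma has_field_derivative_csqrt_power:
  assumes "z \<notin> \<real>\<^sub>\<le>\<^sub>0"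
  shows "((\<lambda>z. csqrt z ^ k) has_field_derivative of_nat k / (2 * z) * csqrt z ^ k) (at z)"
proof (cases k)
  case (Suc j)
  have nz: "csqrt z \<noteq> 0" "z \<noteq> 0" using assms by auto
  have "z = csqrt z * csqrt z" by (simp flip: power2_eq_square)
  then have "inverse (2 * csqrt z) = csqrt z / (2 * z)"
    using nz by (simp add: field_simps)
  then show ?thesis
    unfolding Suc
    by (intro DERIV_cong[OF DERIV_power[OF has_field_derivative_csqrt[OF assms]]])
      (simp del: of_nat_Suc)
qed simp

lemma isCont_csqrt_0: "isCont csqrt 0"
proof -
  have "((\<lambda>z. norm (csqrt z)) \<longlongrightarrow> sqrt (norm (0::complex))) (at 0)"
    unfolding norm_csqrt by (intro tendsto_intros)
  then show ?thesis
    unfolding isCont_def by (intro tendsto_norm_zero_cancel[of csqrt] | simp)+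
qed

context contour
begin

text \<open>The starting point 0 lies on the cut of the principal square root, but the square root is
continuous there because its modulus tends to 0.\<close>

lemma csqrt_\<gamma>_cont: "continuous_on {0..} (\<lambda>s. csqrt (\<gamma> s))"
  unfolding continuous_on_eq_continuous_within
proof
  fix s :: real assume s: "s \<in> {0..}"
  have "isCont csqrt (\<gamma> s)"
  proof (cases "s = 0")
    case True
    then show ?thesis using isCont_csqrt_0 by (simp add: \<gamma>_0)
  next
    case False
    then show ?thesis using s \<gamma>_nonpos[of s] by (intro continuous_at_csqrt) auto
  qed
  moreover have "continuous (at s within {0..}) \<gamma>"
    using \<gamma>_cont s by (simp add: continuous_on_eq_continuous_within)
  ultimately show "continuous (at s within {0..}) (\<lambda>s. csqrt (\<gamma> s))"
    by (rule continuous_within_compose3)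
qed

lemma tame_exp:
  fixes c :: real and q :: "complex poly"
  assumes cont: "continuous_on {0..} (\<lambda>s. g (\<gamma> s))" and c: "c > 1"
    and bound: "\<forall>\<^sub>F s in at_top. norm (g (\<gamma> s)) \<le> norm (poly q (of_real s))"
  shows "tame (\<lambda>z. g z * exp (- of_real c * z))"
proof -
  have lim: "((\<lambda>s. exp (- (c - 1) * s) * norm (poly q (complex_of_real s))) \<longlongrightarrow> 0) at_top"
    by (rule poly_exp_decay) (use c in simp)
  have "((\<lambda>s. of_real (exp s) * (g (\<gamma> s) * exp (- of_real c * \<gamma> s))) \<longlongrightarrow> 0) at_top"
  proof (rule Lim_null_comparison[OF _ lim])
    show "\<forall>\<^sub>F s in at_top. norm (of_real (exp s) * (g (\<gamma> s) * exp (- of_real c * \<gamma> s)))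
        \<le> exp (- (c - 1) * s) * norm (poly q (complex_of_real s))"
      using bound \<gamma>_end
    proof eventually_elim
      case (elim s)
      have e: "exp s * exp (- c * s) = exp (- (c - 1) * s)"
        by (simp add: algebra_simps flip: exp_add)
      have n: "norm (exp (- of_real c * \<gamma> s)) = exp (- c * s)"
        by (simp add: elim(2) norm_exp_eq_Re)
      have "norm (of_real (exp s) * (g (\<gamma> s) * exp (- of_real c * \<gamma> s)))
          = exp s * (norm (g (\<gamma> s)) * exp (- c * s))"
        unfolding norm_mult n by simp
      also have "\<dots> = (exp s * exp (- c * s)) * norm (g (\<gamma> s))"
        by (simp only: mult_ac)
      finally have "norm (of_real (exp s) * (g (\<gamma> s) * exp (- of_real c * \<gamma> s)))
          = exp (- (c - 1) * s) * norm (g (\<gamma> s))"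
        unfolding e .
      then show ?case using elim(1) by (simp add: mult_left_mono)
    qed
  qed
  then show ?thesis
    unfolding tame_def using cont \<gamma>_cont by (auto intro!: continuous_intros)
qed

lemma poly_\<gamma>_cont: "continuous_on {0..} (\<lambda>s. poly p (\<gamma> s))"
  using \<gamma>_cont by (intro continuous_intros)

lemma tame_poly_exp:
  assumes "m \<ge> 2"
  shows "tame (\<lambda>z. poly q z * exp (- of_nat m * z))"
  using tame_exp[of "poly q" "of_nat m" q, OF poly_\<gamma>_cont] assms \<gamma>_end
  by (simp add: eventually_mono)

text \<open>The integrand is the derivative of q(z) exp (- m z). All moments of the exponential weight, and with
them the Pearson equation, follow from this without deforming the contour.\<close>

lemma contour_int_exp_derivative:
  assumes m: "m \<ge> 2"
  shows "contour_int \<gamma> (\<lambda>z. poly (pderiv q - Polynomial.smult (of_nat m) q) z * exp (- of_nat m * z))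
    = - poly q 0"
proof -
  let ?F = "\<lambda>s. poly q (\<gamma> s) * exp (- of_nat m * \<gamma> s)"
  have "contour_int \<gamma> (\<lambda>z. poly (pderiv q - Polynomial.smult (of_nat m) q) z * exp (- of_nat m * z))
    = - ?F 0"
  proof (rule contour_int_primitive[OF tame_poly_exp[OF m], of ?F])
    show "continuous_on {0..} ?F"
      using poly_\<gamma>_cont \<gamma>_cont by (intro continuous_intros)
    show "(?F \<longlongrightarrow> 0) at_top" using tame_tendsto_0[OF tame_poly_exp[OF m]] by simp
    fix s assume "s > 0" and d: "(\<gamma> has_vector_derivative vector_derivative \<gamma> (at s)) (at s)"
    have "((\<lambda>z. poly q z * exp (- of_nat m * z)) has_field_derivative
        poly (pderiv q - Polynomial.smult (of_nat m) q) (\<gamma> s) * exp (- of_nat m * \<gamma> s)) (at (\<gamma> s))"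
      by (auto intro!: derivative_eq_intros simp: algebra_simps)
    from field_vector_diff_chain_at[OF d this]
    show "(?F has_vector_derivative poly (pderiv q - Polynomial.smult (of_nat m) q) (\<gamma> s)
        * exp (- of_nat m * \<gamma> s) * vector_derivative \<gamma> (at s)) (at s)"
      by (simp add: o_def mult.commute)
  qed
  then show ?thesis by (simp add: \<gamma>_0)
qed

lemma contour_int_monom_exp:
  assumes m: "m \<ge> 2"
  shows "contour_int \<gamma> (\<lambda>z. poly (monom 1 k) z * exp (- of_nat m * z)) = fact k / of_nat m ^ Suc k"
proof (induction k)
  case 0
  show ?case
    using contour_int_exp_derivative[OF m, of 1] contour_int_cmult[of "- of_nat m" "\<lambda>z. exp (- of_nat m * z)"] m
    by (simp add: field_simps)
next
  case (Suc k)
  let ?I = "\<lambda>k. contour_int \<gamma> (\<lambda>z. poly (monom 1 k) z * exp (- of_nat m * z))"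
  have eq: "poly (pderiv (monom 1 (Suc k)) - Polynomial.smult (of_nat m) (monom 1 (Suc k))) z * exp (- of_nat m * z)
      = of_nat (Suc k) * (poly (monom 1 k) z * exp (- of_nat m * z))
        + - of_nat m * (poly (monom 1 (Suc k)) z * exp (- of_nat m * z))" for z :: complex
    by (simp add: pderiv_monom poly_monom algebra_simps)
  have "of_nat (Suc k) * ?I k + - of_nat m * ?I (Suc k) = 0"
    using contour_int_exp_derivative[OF m, of "monom 1 (Suc k)"]
    unfolding eq
    by (subst (asm) contour_int_add[OF tame_cmult[OF tame_poly_exp[OF m]] tame_cmult[OF tame_poly_exp[OF m]]])
      (simp only: contour_int_cmult poly_monom, simp)
  then have "of_nat m * ?I (Suc k) = of_nat (Suc k) * ?I k" by (simp add: algebra_simps)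
  then show ?case using m unfolding Suc by (simp add: field_simps)
qed

end

section \<open>The weight of the ensemble\<close>

text \<open>The setting of the theorem without the orthogonal polynomials. The bound on M makes exp (- M x / 2)
decay faster than exp (- x).\<close>

locale laguerre_contour = contour \<gamma> for \<gamma> +
  fixes M N :: nat and \<tau> :: real and t :: complex and \<rho> :: "complex \<Rightarrow> complex"
  assumes N_less_M: "N < M" and M_ge: "M \<ge> 3"
    and \<tau>: "\<tau> > -1" "\<tau> \<noteq> 0"
    and avoids: "t / ttau \<tau> \<notin> \<gamma> ` {0..}"
    and branch: "sqrt_branch \<gamma> \<tau> t \<rho>"
begin

abbreviation a :: complex where "a \<equiv> ttau \<tau>"
abbreviation w :: "complex \<Rightarrow> complex" where "w \<equiv> weight M N \<rho>"

lemma a_nonzero: "a \<noteq> 0"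
proof -
  have "\<tau> / (2 * (1 + \<tau>)) \<noteq> 0" using \<tau> by simp
  then show ?thesis unfolding ttau_def by (simp only: of_real_eq_0_iff) simp
qed

lemma \<rho>_square: "s \<ge> 0 \<Longrightarrow> \<rho> (\<gamma> s) ^ 2 = t - a * \<gamma> s"
  using branch by (auto simp: sqrt_branch_def)

lemma \<rho>_nonzero:
  assumes "s \<ge> 0"
  shows "\<rho> (\<gamma> s) \<noteq> 0"
proof
  assume "\<rho> (\<gamma> s) = 0"
  then have "t = a * \<gamma> s" using \<rho>_square[OF assms] by simp
  then have "t / a = \<gamma> s" using a_nonzero by simp
  then show False using avoids assms by auto
qed

lemma \<rho>_cont: "continuous_on {0..} (\<lambda>s. \<rho> (\<gamma> s))"
  using branch \<gamma>_cont unfolding sqrt_branch_def by (auto intro: continuous_on_compose2)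

text \<open>The square of the modulus of \<rho> is that of t - a x, which grows linearly.\<close>

lemma inverse_\<rho>_bounded: "\<forall>\<^sub>F s in at_top. norm (inverse (\<rho> (\<gamma> s))) \<le> 1"
  using \<gamma>_end eventually_ge_at_top[of 0] eventually_ge_at_top[of "(1 + norm t) / norm a"]
proof eventually_elim
  case (elim s)
  have "1 + norm t \<le> norm (a * \<gamma> s)"
    using elim a_nonzero by (simp add: norm_mult field_simps)
  then have "1 \<le> norm (t - a * \<gamma> s)"
    using norm_triangle_ineq2[of "a * \<gamma> s" t] by (simp add: norm_minus_commute)
  then have "1 \<le> norm (\<rho> (\<gamma> s)) ^ 2"
    using \<rho>_square[of s] elim by (metis norm_power)
  then have "1 \<le> norm (\<rho> (\<gamma> s))"
    using power2_le_imp_le[of 1 "norm (\<rho> (\<gamma> s))"] by simp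
  then show ?case by (simp add: norm_inverse inverse_le_1_iff)
qed

lemma tame_weight_poly: "tame (\<lambda>z. poly p z * w z)"
proof -
  let ?k = "M - N - 1"
  let ?g = "\<lambda>z. poly p z * csqrt z ^ ?k * inverse (\<rho> z)"
  have "tame (\<lambda>z. ?g z * exp (- of_real (real M / 2) * z))"
  proof (rule tame_exp[of _ _ "p * [:1, 1:] ^ ?k"])
    show "continuous_on {0..} (\<lambda>s. ?g (\<gamma> s))"
      using \<gamma>_cont csqrt_\<gamma>_cont \<rho>_cont \<rho>_nonzero by (intro continuous_intros) auto
    show "1 < real M / 2" using M_ge by simp
    show "\<forall>\<^sub>F s in at_top. norm (?g (\<gamma> s)) \<le> norm (poly (p * [:1, 1:] ^ ?k) (of_real s))"
      using inverse_\<rho>_bounded \<gamma>_end eventually_ge_at_top[of 0]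
    proof eventually_elim
      case (elim s)
      have "sqrt s \<le> 1 + s"
        using elim(3) by (intro real_le_lsqrt) (auto simp: power2_eq_square algebra_simps)
      then have "norm (csqrt (\<gamma> s) ^ ?k) \<le> (1 + s) ^ ?k"
        using elim(2,3) by (simp add: norm_power power_mono)
      also have "\<dots> = norm ((1 + complex_of_real s) ^ ?k)"
        using elim(3) norm_of_real[where 'a=complex, of "1 + s"] by (simp add: norm_power)
      finally have "norm (poly p (\<gamma> s)) * norm (csqrt (\<gamma> s) ^ ?k) * norm (inverse (\<rho> (\<gamma> s)))
          \<le> norm (poly p (\<gamma> s)) * norm ((1 + complex_of_real s) ^ ?k) * 1"
        using elim(1) by (intro mult_mono) auto
      then show ?case using elim(2) by (simp add: norm_mult)
    qed
  qed
  then show ?thesis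
    by (simp add: weight_def mult_ac)
qed

sublocale tame_weight \<gamma> w
  by unfold_locales (rule tame_weight_poly)

text \<open>The numerator of the logarithmic derivative: w' / w = - M / 2 + (M - N - 1) / (2 x) + a / (2 (t - a x)), so
for A(x) = x (t - a x) the function D p = (p A)' + p A w' / w is a polynomial.\<close>

definition D :: "complex poly \<Rightarrow> complex poly" where
  "D p = pCons 0 ([:t, - a:] * pderiv p)
     + [: t * (of_nat (M - N) + 1) / 2, - (a + a * of_nat (M - N) / 2 + of_nat M * t / 2), a * of_nat M / 2 :] * p"

lemma weight_primitive:
  assumes s: "s > 0" and d: "(\<gamma> has_vector_derivative d) (at s)"
  shows "((\<lambda>s. poly p (\<gamma> s) * (\<gamma> s * (t - a * \<gamma> s)) * w (\<gamma> s)) has_vector_derivative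
           poly (D p) (\<gamma> s) * w (\<gamma> s) * d) (at s)"
proof -
  define k where "k = M - N - 1"
  have MN: "M - N = Suc k" using N_less_M by (simp add: k_def)
  let ?Z = "\<gamma> s" and ?r = "\<rho> (\<gamma> s)"
  let ?X = "exp (- of_nat M * ?Z / 2) * csqrt ?Z ^ k"
  let ?G = "\<lambda>z. poly p z * (z * (t - a * z)) * exp (- of_nat M * z / 2) * csqrt z ^ k"
  have Z: "?Z \<noteq> 0" using \<gamma>_nonpos[OF s] by auto
  have r: "?r \<noteq> 0" "?r ^ 2 = t - a * ?Z" using s \<rho>_nonzero \<rho>_square by auto
  \<comment> \<open>The contribution of all factors of p A w other than the inverse square root.\<close>
  define H where "H = poly (pderiv p) ?Z * (?Z * (t - a * ?Z)) + poly p ?Z * (t - 2 * a * ?Z)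
      + poly p ?Z * (t - a * ?Z) * (of_nat k / 2 - of_nat M * ?Z / 2)"
  have "((\<lambda>z. poly p z * (z * (t - a * z)) * exp (- of_nat M * z / 2)) has_field_derivative
      (poly (pderiv p) ?Z * (?Z * (t - a * ?Z)) + poly p ?Z * (t - 2 * a * ?Z)
        - of_nat M / 2 * (poly p ?Z * (?Z * (t - a * ?Z)))) * exp (- of_nat M * ?Z / 2)) (at ?Z)"
    by (auto intro!: derivative_eq_intros simp: algebra_simps)
  from DERIV_mult[OF this has_field_derivative_csqrt_power[OF \<gamma>_nonpos[OF s], of k]]
  have "(?G has_field_derivative (H * ?X)) (at ?Z)"
    by (rule DERIV_cong) (use Z in \<open>simp add: H_def field_simps\<close>)
  from field_vector_diff_chain_at[OF d this]
  have G: "((\<lambda>s. ?G (\<gamma> s)) has_vector_derivative d * (H * ?X)) (at s)" by (simp add: o_def)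
  have "isCont (\<lambda>s. \<rho> (\<gamma> s)) s"
    using continuous_on_interior[OF \<rho>_cont, of s] s by simp
  moreover have "\<forall>\<^sub>F u in nhds s. \<rho> (\<gamma> u) ^ 2 = t - a * \<gamma> u"
    using eventually_nhds_in_open[of "{0<..}" s] s by (auto elim!: eventually_mono simp: \<rho>_square)
  moreover have "((\<lambda>u. t - a * \<gamma> u) has_vector_derivative - a * d) (at s)"
    using d by (auto intro!: derivative_eq_intros)
  ultimately have "((\<lambda>s. \<rho> (\<gamma> s)) has_vector_derivative - a * d / (2 * ?r)) (at s)"
    using r(1) by (intro has_vector_derivative_sqrt_branch)
  from field_vector_diff_chain_at[OF this DERIV_inverse[OF r(1)]]
  have inv: "((\<lambda>s. inverse (\<rho> (\<gamma> s))) has_vector_derivative a * d / (2 * ?r ^ 3)) (at s)"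
    using r(1) by (simp add: o_def field_simps power2_eq_square power3_eq_cube)
  have "((\<lambda>s. ?G (\<gamma> s) * inverse (\<rho> (\<gamma> s))) has_vector_derivative
      ?G ?Z * (a * d / (2 * ?r ^ 3)) + d * (H * ?X) * inverse ?r) (at s)"
    by (rule has_vector_derivative_mult[OF G inv])
  moreover have "?G ?Z * (a * d / (2 * ?r ^ 3)) + d * (H * ?X) * inverse ?r
      = poly (D p) ?Z * (?X * inverse ?r) * d"
  proof -
    have "?G ?Z * (a * d / (2 * ?r ^ 3)) = (poly p ?Z * (?Z * ?r ^ 2) * ?X) * (a * d / (2 * ?r ^ 3))"
      unfolding r(2) by (simp only: mult.assoc)
    also have "\<dots> = (poly p ?Z * ?Z * a / 2) * (?X * inverse ?r) * d"
      using r(1) by (simp add: field_simps power2_eq_square power3_eq_cube)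
    finally have 1: "?G ?Z * (a * d / (2 * ?r ^ 3)) = (poly p ?Z * ?Z * a / 2) * (?X * inverse ?r) * d" .
    have "poly (D p) ?Z = poly p ?Z * ?Z * a / 2 + H"
      unfolding D_def MN H_def by (simp add: field_simps)
    then show ?thesis unfolding 1 by (simp only: distrib_right distrib_left mult_ac)
  qed
  ultimately show ?thesis
    by (simp add: weight_def k_def mult.assoc)
qed

lemma eps_op_D:
  assumes "u \<ge> 0"
  shows "eps_op \<gamma> (\<lambda>z. poly (D p) z * w z) (\<gamma> u)
    = poly p (\<gamma> u) * (\<gamma> u * (t - a * \<gamma> u)) * w (\<gamma> u)"
proof -
  let ?q = "p * [:0, t, - a:]"
  have F: "poly ?q (\<gamma> s) * w (\<gamma> s) = poly p (\<gamma> s) * (\<gamma> s * (t - a * \<gamma> s)) * w (\<gamma> s)" for s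
    by (simp add: algebra_simps)
  show ?thesis
  proof (rule eps_op_primitive[OF tame_weight_poly _ _ _ _ assms])
    show "continuous_on {0..} (\<lambda>s. poly p (\<gamma> s) * (\<gamma> s * (t - a * \<gamma> s)) * w (\<gamma> s))"
      using tame_weight_poly[of ?q] unfolding tame_def F by simp
    show "((\<lambda>s. poly p (\<gamma> s) * (\<gamma> s * (t - a * \<gamma> s)) * w (\<gamma> s)) \<longlongrightarrow> 0) at_top"
      using tame_tendsto_0[OF tame_weight_poly[of ?q]] unfolding F .
  qed (auto simp: \<gamma>_0 weight_primitive)
qed

text \<open>The identity w^2 A = w0, which links the skew form to the Laguerre weight.\<close>

lemma weight_square:
  assumes "u \<ge> 0"
  shows "w (\<gamma> u) * w (\<gamma> u) * (\<gamma> u * (t - a * \<gamma> u)) = weight0 M N (\<gamma> u)"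
proof -
  define k where "k = M - N - 1"
  have MN: "M - N = Suc k" using N_less_M by (simp add: k_def)
  let ?z = "\<gamma> u"
  have "csqrt ?z ^ k * csqrt ?z ^ k = ?z ^ k"
    by (metis power2_csqrt power2_eq_square power_mult_distrib)
  moreover have "exp (- of_nat M * ?z / 2) * exp (- of_nat M * ?z / 2) = exp (- of_nat M * ?z)"
    by (simp flip: exp_add)
  moreover have "inverse (\<rho> ?z) * inverse (\<rho> ?z) * (t - a * ?z) = 1"
    unfolding \<rho>_square[OF assms, symmetric] using \<rho>_nonzero[OF assms] by (simp add: power2_eq_square field_simps)
  moreover have "w ?z * w ?z * (?z * (t - a * ?z))
      = (exp (- of_nat M * ?z / 2) * exp (- of_nat M * ?z / 2)) * (?z * (csqrt ?z ^ k * csqrt ?z ^ k))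
        * (inverse (\<rho> ?z) * inverse (\<rho> ?z) * (t - a * ?z))"
    unfolding weight_def MN by (simp add: mult_ac)
  ultimately show ?thesis
    unfolding weight0_def MN by (simp add: mult_ac)
qed

definition moment :: "complex poly \<Rightarrow> complex" where
  "moment p = contour_int \<gamma> (\<lambda>z. poly p z * weight0 M N z)"

lemma moment_eq: "moment p = contour_int \<gamma> (\<lambda>z. poly (p * monom 1 (M - N)) z * exp (- of_nat M * z))"
  unfolding moment_def by (rule contour_int_cong) (simp add: weight0_def poly_monom)

lemma M_ge_2: "M \<ge> 2" using M_ge by simp

lemma moment_add: "moment (p + q) = moment p + moment q"
  unfolding moment_eq
  by (subst contour_int_add[OF tame_poly_exp[OF M_ge_2] tame_poly_exp[OF M_ge_2], symmetric])
    (simp add: algebra_simps)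

lemma moment_smult: "moment (Polynomial.smult c p) = c * moment p"
  unfolding moment_eq by (subst contour_int_cmult[symmetric]) (simp add: mult.assoc)

lemma moment_pearson:
  "moment (Polynomial.smult (of_nat (Suc (M - N))) p + pCons 0 (pderiv p)
     - Polynomial.smult (of_nat M) (pCons 0 p)) = 0"
proof -
  let ?q = "p * monom 1 (Suc (M - N))"
  have "(Polynomial.smult (of_nat (Suc (M - N))) p + pCons 0 (pderiv p)
     - Polynomial.smult (of_nat M) (pCons 0 p)) * monom 1 (M - N)
     = pderiv ?q - Polynomial.smult (of_nat M) ?q"
  proof -
    have mS: "monom 1 (Suc (M - N)) = pCons 0 (monom (1::complex) (M - N))" by (rule monom_Suc)
    have pd: "pderiv (monom 1 (Suc (M - N))) = Polynomial.smult (of_nat (Suc (M - N))) (monom (1::complex) (M - N))"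
      by (simp add: pderiv_monom smult_monom)
    show ?thesis
      unfolding pderiv_mult pd unfolding mS by (simp add: algebra_simps)
  qed
  then show ?thesis
    unfolding moment_eq using contour_int_exp_derivative[OF M_ge_2, of ?q]
    by (simp add: poly_monom)
qed

lemma moment_1: "moment 1 \<noteq> 0"
  unfolding moment_eq using contour_int_monom_exp[OF M_ge_2, of "M - N"] M_ge by simp

text \<open>Integration by parts: epsilon of (D p) w is p A w, and w times p A w is p w0.\<close>

lemma skew1_D: "skew1 \<gamma> w (D p) f = - moment (f * p)"
proof -
  have "contour_int \<gamma> (\<lambda>y. poly f y * w y * eps_op \<gamma> (\<lambda>z. poly (D p) z * w z) y) = moment (f * p)"
    unfolding moment_def
  proof (rule contour_int_cong)
    fix s :: real assume s: "s \<ge> 0"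
    show "poly f (\<gamma> s) * w (\<gamma> s) * eps_op \<gamma> (\<lambda>z. poly (D p) z * w z) (\<gamma> s)
        = poly (f * p) (\<gamma> s) * weight0 M N (\<gamma> s)"
      unfolding eps_op_D[OF s] weight_square[OF s, symmetric] by (simp add: mult_ac)
  qed
  then show ?thesis unfolding skew1_eq_eps_op by simp
qed

end

section \<open>The correction to the Laguerre kernel\<close>

theorem theorem2:
  fixes M N :: nat and \<tau> :: real and t :: complex
    and \<gamma> :: "real \<Rightarrow> complex" and \<rho> w :: "complex \<Rightarrow> complex"
    and L \<pi>1 r :: "nat \<Rightarrow> complex poly" and h :: "nat \<Rightarrow> complex"
  assumes "N < M" and "4 \<le> N" and "even N"
    and "\<tau> > -1" and "\<tau> \<noteq> 0" and "t \<noteq> 0"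
    and "halfline_contour \<gamma>" and "t / ttau \<tau> \<notin> \<gamma> ` {0..}"
    and "sqrt_branch \<gamma> \<tau> t \<rho>"
    and w: "w = weight M N \<rho>"
    and "monic_laguerre \<gamma> M N L h"
    and "skew1 \<gamma> w (L (N - 1)) (L (N - 2)) \<noteq> 0"
    and "skew1 \<gamma> w (L (N - 3)) (L (N - 4)) \<noteq> 0"
    and "\<forall>n\<in>{N - 2, N - 1, N}. skew_orthogonal \<gamma> w n (\<pi>1 n)"
    and "\<pi>1 (N + 1) = L (N + 1)
           - Polynomial.smult (skew1 \<gamma> w (L (N + 1)) (L (N - 2)) / skew1 \<gamma> w (L (N - 1)) (L (N - 2)))
               (L (N - 1))
           + Polynomial.smult (skew1 \<gamma> w (L (N + 1)) (L (N - 1)) / skew1 \<gamma> w (L (N - 1)) (L (N - 2)))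
               (L (N - 2))"
    and "\<forall>j < N - 2. monic_of_degree j (r j)"
    and "r (N - 2) = \<pi>1 (N - 2)" and "r (N - 1) = \<pi>1 (N - 1)"
  shows "invertible_mat (moment_mat \<gamma> w N r) \<and>
    (\<forall>x\<in>\<gamma> ` {0..}. \<forall>y\<in>\<gamma> ` {0..}.
      S1 \<gamma> w N r x y - K2 M N \<rho> L h x y =
        (vec_of_list [eps_op \<gamma> (\<lambda>z. poly (\<pi>1 (N + 1)) z * w z) y,
                      eps_op \<gamma> (\<lambda>z. poly (\<pi>1 N) z * w z) y]
         \<bullet> (mat_of_rows_list 2
              [[0, - (of_nat M * ttau \<tau> / (2 * h (N - 1)))],
               [- (of_nat M * ttau \<tau> / (2 * h (N - 2))),
                (of_nat M * t - ttau \<tau> * (of_nat M + of_nat N)) / (2 * h (N - 1))]]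
            *\<^sub>v vec_of_list [poly (L (N - 2)) x, poly (L (N - 1)) x]))
        * w x)"
proof -
  interpret laguerre_contour \<gamma> M N \<tau> t \<rho>
    using assms by unfold_locales auto
  define n where "n = N - 2"
  have N_eq: "N = n + 2" and N: "N - 1 = Suc n" "N - 2 = n" "N + 1 = n + 3"
    using \<open>4 \<le> N\<close> by (auto simp: n_def)
  have L: "monic_of_degree j (L j)" "moment (L j * L k) = (if j = k then h j else 0)" for j k
    using \<open>monic_laguerre \<gamma> M N L h\<close> by (auto simp: monic_laguerre_def moment_def mult.assoc)
  have M_eq: "of_nat M = (of_nat (M - N + n + 2) :: complex)"
    using N_eq \<open>N < M\<close> by (intro arg_cong[of _ _ of_nat]) simp
  have M_nonzero: "of_nat M \<noteq> (0 :: complex)" using \<open>N < M\<close> by simp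
  note skew_rules = skew1_add[folded w] skew1_smult[folded w] skew1_skew[folded w]
    skew1_D[folded w, unfolded D_def]
  interpret S: skew_laguerre moment "M - N" "of_nat M" L h a t n "skew1 \<gamma> w" D
    by unfold_locales
      (rule moment_add moment_smult moment_pearson moment_1 L a_nonzero M_eq M_nonzero skew_rules
        assms(12)[unfolded N(1,2)] D_def[abs_def])+
  have \<pi>_top: "\<pi>1 (N + 1) = S.pi_top"
    using assms(15) unfolding S.pi_top_def N .
  have \<pi>N: "monic_of_degree (n + 2) (\<pi>1 N)" "j < N \<Longrightarrow> skew1 \<gamma> w (\<pi>1 N) (monom 1 j) = 0" for j
    using assms(14) \<open>even N\<close> N_eq by (auto simp: skew_orthogonal_def)
  have \<pi>N_orth: "skew1 \<gamma> w (\<pi>1 N) f = 0" if "f \<in> poly_below (n + 2)" for f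
  proof -
    have "\<forall>j<N. monic_of_degree j (monom 1 j)"
      by (simp add: monic_of_degree_def degree_monom_eq)
    then obtain c where c: "f = (\<Sum>j<N. Polynomial.smult (c j) (monom 1 j))"
      using monic_family_spans \<open>f \<in> poly_below (n + 2)\<close> N_eq by metis
    have zero: "skew1 \<gamma> w (\<pi>1 N) 0 = 0"
      using S.B_smult_right[of "\<pi>1 N" 0 0] by simp
    have "skew1 \<gamma> w (\<pi>1 N) (\<Sum>j\<in>A. g j) = (\<Sum>j\<in>A. skew1 \<gamma> w (\<pi>1 N) (g j))"
      for A :: "nat set" and g
      by (induction A rule: infinite_finite_induct) (auto simp: S.B_add_right zero)
    then show ?thesis
      unfolding c by (auto simp: S.B_smult_right \<pi>N(2) intro!: sum.neutral)
  qed
  \<comment> \<open>The polynomial kernel from which S_1 is obtained by applying epsilon.\<close>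
  define Q where "Q = S.skew_kernel (\<pi>1 N)"
  have r: "\<forall>j<N. monic_of_degree j (r j)"
  proof (intro allI impI)
    fix j assume "j < N"
    then consider "j < N - 2" | "j = N - 2" | "j = N - 1" by linarith
    then show "monic_of_degree j (r j)"
      by cases (use assms(14,16-18) in \<open>auto simp: skew_orthogonal_def\<close>)
  qed
  have Q: "Q x \<in> poly_below N" "f \<in> poly_below N \<Longrightarrow> skew1 \<gamma> w (Q x) f = poly f x" for x f
    using S.skew_kernel_below[OF \<pi>N(1)] S.skew_kernel_reproducing \<pi>N_orth
    by (simp_all add: Q_def N_eq)
  note inverse = inverse_of_moment_matrix[of "skew1 \<gamma> w", OF S.B_add S.B_smult S.B_skew r Q,
      folded moment_mat_def]
  show ?thesis
  proof (intro conjI ballI)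
    show "invertible_mat (moment_mat \<gamma> w N r)" by (rule inverse(1))
  next
    fix x y assume "x \<in> \<gamma> ` {0..}" "y \<in> \<gamma> ` {0..}"
    then obtain u where u: "u \<ge> 0" "y = \<gamma> u" by auto
    \<comment> \<open>All terms of the claim are values of this linear functional of polynomials.\<close>
    define E where "E = (\<lambda>p. eps_op \<gamma> (\<lambda>z. poly p z * w z) y)"
    have E_sum: "E (\<Sum>j\<in>A. Polynomial.smult (c j) (f j)) = (\<Sum>j\<in>A. c j * E (f j))"
      for A :: "nat set" and c f
      unfolding E_def u(2) w by (rule eps_op_sum[OF u(1)])
    have E_smult: "E (Polynomial.smult c f) = c * E f" for c f
      using E_sum[of "\<lambda>_. c" "\<lambda>_. f" "{0}"] by simp
    have E_add: "E (f + g) = E f + E g" for f g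
      using E_sum[of "\<lambda>_. 1" "\<lambda>j. if j = 0 then f else g" "{0, 1}"] by simp
    have E_minus: "E (- f) = - E f" for f using E_smult[of "-1" f] by simp
    have "E (Q x) = (\<Sum>j<N. \<Sum>k<N. poly (r j) x * (the (mat_inverse (moment_mat \<gamma> w N r)) $$ (j, k)) * E (r k))"
    proof -
      let ?c = "\<lambda>j k. poly (r j) x * (the (mat_inverse (moment_mat \<gamma> w N r)) $$ (j, k))"
      have "E (\<Sum>j<N. g j) = (\<Sum>j<N. E (g j))" for g
        using E_sum[of "\<lambda>_. 1" g "{..<N}"] by (simp only: smult_1_left mult_1)
      then have E_expand: "E (\<Sum>j<N. \<Sum>k<N. Polynomial.smult (?c j k) (r k))
          = (\<Sum>j<N. E (\<Sum>k<N. Polynomial.smult (?c j k) (r k)))" .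
      have Q_expand: "Q x = (\<Sum>j<N. \<Sum>k<N. Polynomial.smult (?c j k) (r k))"
        by (rule inverse(2))
      show ?thesis by (rule trans[OF arg_cong[OF Q_expand, of E] E_expand[unfolded E_sum]])
    qed
    then have S1: "S1 \<gamma> w N r x y = - w x * E (Q x)"
      unfolding S1_def E_def by (simp add: sum_distrib_left sum_negf mult_ac)
    \<comment> \<open>The quotient has this form also at y = 0, where w may vanish: both sides are then 0.\<close>
    have "weight0 M N y / w y = y * (t - a * y) * w y"
      using weight_square[OF u(1)] unfolding w u(2) by (cases "weight M N \<rho> (\<gamma> u) = 0") (auto simp: field_simps)
    moreover have "cd_quotient (L N) (L (N - 1)) x y / h (N - 1) = poly (S.cd_kernel N x) y"
      using S.cd_kernel_eq_cd_quotient[of "Suc n" x y] by (simp add: N_eq)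
    moreover have "K2 M N \<rho> L h x y
        = w x * (weight0 M N y / w y) * (cd_quotient (L N) (L (N - 1)) x y / h (N - 1))"
      by (simp add: K2_def w)
    ultimately have "K2 M N \<rho> L h x y = w x * (poly (S.cd_kernel N x) y * (y * (t - a * y)) * w y)"
      by (simp only: mult_ac)
    also have "poly (S.cd_kernel N x) y * (y * (t - a * y)) * w y = E (D (S.cd_kernel N x))"
      unfolding E_def u(2) w by (rule eps_op_D[OF u(1), symmetric])
    finally have K2: "K2 M N \<rho> L h x y = w x * E (D (S.cd_kernel N x))" .
    have collect: "- v * q - v * k = (e1 * (- b1 * l1) + e0 * (- b2 * l2 + c * l1)) * v"
      if "q = - k + b1 * l1 * e1 + (b2 * l2 - c * l1) * e0" for v q k e0 e1 b1 b2 l1 l2 c :: complex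
      unfolding that by (simp add: algebra_simps)
    have E_Q: "E (Q x) = - E (D (S.cd_kernel N x))
        + of_nat M * a / (2 * h (N - 1)) * poly (L (N - 1)) x * E (\<pi>1 (N + 1))
        + (of_nat M * a / (2 * h (N - 2)) * poly (L (N - 2)) x
           - (of_nat M * t - a * (of_nat M + of_nat N)) / (2 * h (N - 1)) * poly (L (N - 1)) x) * E (\<pi>1 N)"
      unfolding Q_def S.skew_kernel_def N_eq[symmetric] E_add E_smult E_minus \<pi>_top by (simp only: N)
    have "S1 \<gamma> w N r x y - K2 M N \<rho> L h x y
        = (E (\<pi>1 (N + 1)) * (- (of_nat M * a / (2 * h (N - 1))) * poly (L (N - 1)) x)
           + E (\<pi>1 N) * (- (of_nat M * a / (2 * h (N - 2))) * poly (L (N - 2)) x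
              + (of_nat M * t - a * (of_nat M + of_nat N)) / (2 * h (N - 1)) * poly (L (N - 1)) x)) * w x"
      unfolding S1 K2 by (rule collect[OF E_Q])
    also have "\<dots> = (vec_of_list [E (\<pi>1 (N + 1)), E (\<pi>1 N)]
         \<bullet> (mat_of_rows_list 2
              [[0, - (of_nat M * a / (2 * h (N - 1)))],
               [- (of_nat M * a / (2 * h (N - 2))),
                (of_nat M * t - a * (of_nat M + of_nat N)) / (2 * h (N - 1))]]
            *\<^sub>v vec_of_list [poly (L (N - 2)) x, poly (L (N - 1)) x])) * w x"
      by (simp add: scalar_prod_def mat_of_rows_list_def numeral_2_eq_2)
    finally show "S1 \<gamma> w N r x y - K2 M N \<rho> L h x y =
        (vec_of_list [eps_op \<gamma> (\<lambda>z. poly (\<pi>1 (N + 1)) z * w z) y,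
                      eps_op \<gamma> (\<lambda>z. poly (\<pi>1 N) z * w z) y]
         \<bullet> (mat_of_rows_list 2
              [[0, - (of_nat M * ttau \<tau> / (2 * h (N - 1)))],
               [- (of_nat M * ttau \<tau> / (2 * h (N - 2))),
                (of_nat M * t - ttau \<tau> * (of_nat M + of_nat N)) / (2 * h (N - 1))]]
            *\<^sub>v vec_of_list [poly (L (N - 2)) x, poly (L (N - 1)) x])) * w x"
      unfolding E_def .
  qed
qed

end
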